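(* Let $P(y_0,y_1)\in\mathbb{C}[y_0,y_1]$ be a non-zero polynomial with constant coefficients in which $y_1$ actually occurs, defining the autonomous first order ordinary differential equation $P(y,\frac{dy}{dx})=0$. Then: (1) If $s(x)\in\Omega$ is a solution of $P=0$, then $s(x)\in\hat K^{*}$. (2) If $s(x)\in\hat K^{*}$ is a solution of $P=0$, then $s(x)$ is a convergent Puiseux power series. (3) For any point $(x_0,c_0)\in\mathbb{C}^2$ there exists an analytic solution $s(x)$ of $P=0$ passing through the point $(x_0,c_0)$.
   Context: $\Omega$ denotes the field of generalized power series $s(x)=\sum_{i\ge1}c_ix^{\mu_i}$ with $c_i\in\mathbb{C}$, $\mu_i\in\mathbb{R}$ strictly increasing and $\mu_i\to\infty$ when there are infinitely many terms. Here $y_1$ refers to the ordinary derivative $\frac{d}{dx}$, and $s$ is a solution if $P(s(x),\frac{ds}{dx}(x))=0$. $\hat K^{*}=\bigcup_{d\ge1}\mathbb{C}((x^{\frac1d\mathbb{Z}}))$ is the field of formal Puiseux power series.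
   Formalization: In (3), "analytic solution through (x0,c0)" is taken to be a convergent Puiseux series in x−x0 with non-negative exponents and constant term c0, since a solution holomorphic at x0 need not exist (e.g. y·y'=1 with c0=0). *)

theory Defs
  imports "HOL-Analysis.Analysis" "HOL-Computational_Algebra.Polynomial"
begin

text \<open>Generalized power series s(x) = sum c_mu x^mu are represented by their
coefficient function real => complex.  The field Omega: the support is either
finite or a strictly increasing sequence tending to infinity, i.e. every
initial segment of the support is finite.\<close>

type_synonym gser = "real \<Rightarrow> complex"

definition Omega :: "gser set" where
  "Omega = {s. \<forall>r::real. finite {\<mu>. s \<mu> \<noteq> 0 \<and> \<mu> \<le> r}}"

definition gs_const :: "complex \<Rightarrow> gser" where
  "gs_const c = (\<lambda>\<mu>. if \<mu> = 0 then c else 0)"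

text \<open>Cauchy product (the index set is finite for elements of Omega).\<close>
definition gs_mult :: "gser \<Rightarrow> gser \<Rightarrow> gser" where
  "gs_mult f g = (\<lambda>\<mu>. \<Sum>\<alpha>\<in>{\<alpha>. f \<alpha> \<noteq> 0 \<and> g (\<mu> - \<alpha>) \<noteq> 0}. f \<alpha> * g (\<mu> - \<alpha>))"

definition gs_pow :: "gser \<Rightarrow> nat \<Rightarrow> gser" where
  "gs_pow f n = ((gs_mult f) ^^ n) (gs_const 1)"

definition gs_deriv :: "gser \<Rightarrow> gser" where
  "gs_deriv s = (\<lambda>\<mu>. complex_of_real (\<mu> + 1) * s (\<mu> + 1))"

text \<open>A bivariate polynomial P(y0,y1) in C[y0,y1] is represented as
a polynomial in y1 whose coefficients are polynomials in y0, i.e. as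
complex poly poly; the coefficient of y0^i y1^j is coeff (coeff P j) i.\<close>
definition gs_eval :: "complex poly poly \<Rightarrow> gser \<Rightarrow> gser \<Rightarrow> gser" where
  "gs_eval P s t = (\<lambda>\<mu>. \<Sum>j\<le>degree P. \<Sum>i\<le>degree (coeff P j).
      coeff (coeff P j) i * gs_mult (gs_pow s i) (gs_pow t j) \<mu>)"

definition is_solution :: "complex poly poly \<Rightarrow> gser \<Rightarrow> bool" where
  "is_solution P s \<longleftrightarrow> gs_eval P s (gs_deriv s) = (\<lambda>_. 0)"

definition is_puiseux :: "gser \<Rightarrow> bool" where
  "is_puiseux s \<longleftrightarrow> s \<in> Omega \<and>
     (\<exists>d::nat. d \<ge> 1 \<and> (\<forall>\<mu>. s \<mu> \<noteq> 0 \<longrightarrow> (\<exists>k::int. \<mu> = real_of_int k / real d)))"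

text \<open>Convergent Puiseux series: as a Laurent series in t = x^(1/d), the
power series part has positive radius of convergence.\<close>
definition is_conv_puiseux :: "gser \<Rightarrow> bool" where
  "is_conv_puiseux s \<longleftrightarrow> s \<in> Omega \<and>
     (\<exists>d::nat. d \<ge> 1 \<and> (\<forall>\<mu>. s \<mu> \<noteq> 0 \<longrightarrow> (\<exists>k::int. \<mu> = real_of_int k / real d)) \<and>
        (\<exists>r::real. r > 0 \<and> summable (\<lambda>n::nat. norm (s (real n / real d)) * r ^ n)))"

end

(* Let s be a nonconstant solution.  Replacing P by a polynomial of minimal degree in y1 vanishing
   at (s, s'), the partial derivative B = P_{y1}(s, s') is nonzero, and since s' solves the linearized
   equation A v + B v' = 0, that equation has a regular singularity at 0 with exponent the order of s'.

   A Q-linear functional on the reals killing 1 induces a derivation of Omega commuting with d/dx;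
   applied to s it gives a second solution of the linearized equation, so all exponents are rational.
   The tail V of s satisfies (x d/dx + const) V = (polynomial in V and its derivative), whose
   nonconstant coefficients have positive order.  Hence the exponents of V stay in the group generated by
   those of the finitely many coefficients, and a weighted norm of the truncations of V is bounded.

   For existence at (x0, c0) with P(c0, 0) nonzero (otherwise take s constant), put z = y - c0.  Then
   1 / y1 is integral over the power series in z near 0, so it has a Puiseux expansion phi in z;
   integrating dx = phi dz and inverting gives y as a power series in a root of x. *)

theory Submission
  imports Defs "HOL-Computational_Algebra.Formal_Power_Series"
    "HOL-Computational_Algebra.Fundamental_Theorem_Algebra"
    "HOL-Computational_Algebra.Polynomial_FPS"
begin

subsection \<open>The ring of generalized power series\<close>

text \<open>Cutting a solution at \<open>\<nu> \<ge> 1 + \<sigma>\<close>, with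
  \<open>\<sigma>\<close> the order of \<open>s'\<close>, excludes resonance: at an exponent
  \<open>a \<ge> 0\<close> the linear operator for the tail multiplies by
  \<open>a + \<nu> - \<sigma> \<ge> 1\<close>, so the equation determines every coefficient of the
  tail from lower ones. Its coefficients are polynomial in the truncation and its derivative, hence
  have finite support, and finitely many exponents govern the whole series. The recursion only
  propagates what the truncation contains, so it cannot show these exponents rational; that obstacle
  calls for a derivation other than \<open>d/dx\<close>. Convergence is a bound uniform in the
  cut-off: a factor of positive order makes each level depend on lower levels only, with a weight
  that becomes small with the radius.

  For existence a formal solution suffices, since convergence is shown for every solution. The
  reciprocal of \<open>y1\<close> is expanded because \<open>y1\<close> itself may have a pole at
  \<open>z = 0\<close>, whereas the reciprocal has none; integration then meets no
  logarithm.\<close>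

typedef gps = Omega
  morphisms gcoeff Abs_gps
  by (rule exI[of _ "\<lambda>_. 0"]) (simp add: Omega_def)

lemma finite_gcoeff: "finite {a. gcoeff f a \<noteq> 0 \<and> a \<le> r}"
  using gcoeff[of f] by (simp add: Omega_def)

lemma gcoeff_Abs: "(\<And>r. finite {a. f a \<noteq> 0 \<and> a \<le> r}) \<Longrightarrow> gcoeff (Abs_gps f) = f"
  by (rule Abs_gps_inverse) (simp add: Omega_def)

text \<open>The support of \<open>h\<close> lies in the union of two admissible supports, which
  settles membership in \<open>Omega\<close> for all pointwise operations at once.\<close>

lemma gcoeff_Abs_support:
  assumes "\<And>a. gcoeff f a = 0 \<Longrightarrow> gcoeff g a = 0 \<Longrightarrow> h a = 0"
  shows "gcoeff (Abs_gps h) = h"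
proof (rule gcoeff_Abs)
  fix r
  have "finite ({a. gcoeff f a \<noteq> 0 \<and> a \<le> r} \<union> {a. gcoeff g a \<noteq> 0 \<and> a \<le> r})"
    by (simp add: finite_gcoeff)
  then show "finite {a. h a \<noteq> 0 \<and> a \<le> r}"
    by (rule rev_finite_subset) (use assms in blast)
qed

lemma gps_eqI: "(\<And>a. gcoeff f a = gcoeff g a) \<Longrightarrow> f = g"
  using gcoeff_inject by blast

text \<open>Order at least \<open>m\<close>, stated as a relation: the zero series satisfies it for
  every \<open>m\<close>, so no infinite value is required.\<close>

definition vanishes_below :: "real \<Rightarrow> gps \<Rightarrow> bool" where
  "vanishes_below m f \<longleftrightarrow> (\<forall>a<m. gcoeff f a = 0)"

lemma vanishes_belowD: "vanishes_below m f \<Longrightarrow> gcoeff f a \<noteq> 0 \<Longrightarrow> m \<le> a"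
  by (force simp: vanishes_below_def)

lemma vanishes_below_mono: "vanishes_below m f \<Longrightarrow> n \<le> m \<Longrightarrow> vanishes_below n f"
  by (auto simp: vanishes_below_def)

lemma leading_exponent:
  assumes "gcoeff f b \<noteq> 0"
  obtains m where "m \<le> b" "gcoeff f m \<noteq> 0" "vanishes_below m f"
proof -
  let ?S = "{a. gcoeff f a \<noteq> 0 \<and> a \<le> b}"
  have S: "finite ?S" "?S \<noteq> {}" using finite_gcoeff assms by auto
  define m where "m = Min ?S"
  from Min_in[OF S] have m: "m \<le> b" "gcoeff f m \<noteq> 0" by (auto simp: m_def)
  have "gcoeff f a = 0" if "a < m" for a
  proof (rule ccontr)
    assume "gcoeff f a \<noteq> 0"
    then have "a \<in> ?S" using that m by simp
    from Min_le[OF S(1) this] that show False by (simp add: m_def)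
  qed
  with m show ?thesis by (intro that[of m]) (simp_all add: vanishes_below_def)
qed

lemma ex_vanishes_below: "\<exists>m. vanishes_below m f"
proof (cases "\<exists>b. gcoeff f b \<noteq> 0")
  case True
  then show ?thesis using leading_exponent by metis
qed (auto simp: vanishes_below_def)

lemma finite_mult_support: "finite {a. gcoeff f a \<noteq> 0 \<and> gcoeff g (r - a) \<noteq> 0}"
proof -
  obtain m where "vanishes_below m g" using ex_vanishes_below by blast
  then have "a \<le> r - m" if "gcoeff g (r - a) \<noteq> 0" for a
    using vanishes_belowD[of m g "r - a"] that by auto
  then show ?thesis by (intro finite_subset[OF _ finite_gcoeff[of f "r - m"]]) auto
qed

lemma gs_mult_altdef:
  assumes "finite F" "{a. gcoeff f a \<noteq> 0 \<and> gcoeff g (r - a) \<noteq> 0} \<subseteq> F"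
  shows "gs_mult (gcoeff f) (gcoeff g) r = (\<Sum>a\<in>F. gcoeff f a * gcoeff g (r - a))"
  unfolding gs_mult_def using assms by (intro sum.mono_neutral_left) auto

lemma gs_mult_nonzeroD:
  assumes "gs_mult f g r \<noteq> 0"
  obtains a where "f a \<noteq> 0" "g (r - a) \<noteq> 0"
proof -
  obtain a where "a \<in> {a. f a \<noteq> 0 \<and> g (r - a) \<noteq> 0}"
    using assms unfolding gs_mult_def by (rule sum.not_neutral_contains_not_neutral)
  then show ?thesis by (intro that[of a]) simp_all
qed

text \<open>Both supports are bounded below, so an exponent up to \<open>r\<close> of the product
  splits into two exponents that are each bounded above, and there are finitely many such
  pairs.\<close>

lemma gs_mult_in_Omega: "gs_mult (gcoeff f) (gcoeff g) \<in> Omega"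
  unfolding Omega_def mem_Collect_eq
proof
  fix r
  obtain m n where m: "vanishes_below m f" and n: "vanishes_below n g"
    using ex_vanishes_below by metis
  let ?F = "{a. gcoeff f a \<noteq> 0 \<and> a \<le> r - n}" and ?G = "{a. gcoeff g a \<noteq> 0 \<and> a \<le> r - m}"
  have *: "u \<in> (\<lambda>(a,b). a + b) ` (?F \<times> ?G)" if u: "gs_mult (gcoeff f) (gcoeff g) u \<noteq> 0" "u \<le> r" for u
  proof -
    obtain a where a: "gcoeff f a \<noteq> 0" "gcoeff g (u - a) \<noteq> 0" using u gs_mult_nonzeroD by blast
    then have "m \<le> a" "n \<le> u - a" using m n vanishes_belowD by auto
    with a u(2) show ?thesis by (intro image_eqI[of _ _ "(a, u - a)"]) auto
  qed
  have "finite ((\<lambda>(a,b). a + b) ` (?F \<times> ?G))"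
    by (intro finite_imageI finite_cartesian_product finite_gcoeff)
  then show "finite {u. gs_mult (gcoeff f) (gcoeff g) u \<noteq> 0 \<and> u \<le> r}"
    by (rule finite_subset[rotated]) (rule subsetI, rule *, simp_all)
qed

section \<open>Monomials and the ring structure\<close>

definition gmonom :: "complex \<Rightarrow> real \<Rightarrow> gps" where
  "gmonom c m = Abs_gps (\<lambda>a. if a = m then c else 0)"

lemma gcoeff_gmonom: "gcoeff (gmonom c m) a = (if a = m then c else 0)"
  unfolding gmonom_def by (subst gcoeff_Abs) auto

instantiation gps :: comm_ring_1
begin

definition "0 = Abs_gps (\<lambda>_. 0)"
definition "1 = gmonom 1 0"
definition "f + g = Abs_gps (\<lambda>a. gcoeff f a + gcoeff g a)"
definition "f - g = Abs_gps (\<lambda>a. gcoeff f a - gcoeff g a)"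
definition "- f = Abs_gps (\<lambda>a. - gcoeff f a)"
definition "f * g = Abs_gps (gs_mult (gcoeff f) (gcoeff g))"

lemma gcoeff_0 [simp]: "gcoeff 0 a = 0"
  unfolding zero_gps_def by (subst gcoeff_Abs) auto

lemma gcoeff_add [simp]: "gcoeff (f + g) a = gcoeff f a + gcoeff g a"
  unfolding plus_gps_def by (subst gcoeff_Abs_support[of f g]) simp_all

lemma gcoeff_diff [simp]: "gcoeff (f - g) a = gcoeff f a - gcoeff g a"
  unfolding minus_gps_def by (subst gcoeff_Abs_support[of f g]) simp_all

lemma gcoeff_uminus [simp]: "gcoeff (- f) a = - gcoeff f a"
  unfolding uminus_gps_def by (subst gcoeff_Abs_support[of f f]) simp_all

lemma gcoeff_times: "gcoeff (f * g) = gs_mult (gcoeff f) (gcoeff g)"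
  unfolding times_gps_def by (rule Abs_gps_inverse) (rule gs_mult_in_Omega)

lemma gcoeff_mult:
  assumes "finite F" "\<And>a. gcoeff f a \<noteq> 0 \<Longrightarrow> gcoeff g (r - a) \<noteq> 0 \<Longrightarrow> a \<in> F"
  shows "gcoeff (f * g) r = (\<Sum>a\<in>F. gcoeff f a * gcoeff g (r - a))"
  unfolding gcoeff_times using assms by (intro gs_mult_altdef) auto

lemma gcoeff_mult_nonzeroD:
  assumes "gcoeff (f * g) r \<noteq> 0"
  obtains a where "gcoeff f a \<noteq> 0" "gcoeff g (r - a) \<noteq> 0"
  using assms unfolding gcoeff_times by (rule gs_mult_nonzeroD)

lemma gcoeff_gmonom_mult: "gcoeff (gmonom c m * f) r = c * gcoeff f (r - m)"
  by (subst gcoeff_mult[of "{m}"]) (simp_all add: gcoeff_gmonom split: if_splits)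

instance
proof
  fix f g h :: gps
  show "f + g + h = f + (g + h)" "f + g = g + f" "0 + f = f" "- f + f = 0" "f - g = f + - g"
    by (rule gps_eqI, simp add: algebra_simps)+
  show "1 * f = f" by (rule gps_eqI) (simp add: one_gps_def gcoeff_gmonom_mult)
  have "gcoeff (1::gps) 0 \<noteq> gcoeff 0 0" by (simp add: one_gps_def gcoeff_gmonom)
  then show "(0::gps) \<noteq> 1" by metis
  show "f * g = g * f"
  proof (rule gps_eqI)
    fix r
    let ?S = "{a. gcoeff f a \<noteq> 0 \<and> gcoeff g (r - a) \<noteq> 0}"
    have "gcoeff (f * g) r = (\<Sum>a\<in>?S. gcoeff f a * gcoeff g (r - a))"
      by (rule gcoeff_mult) (auto simp: finite_mult_support)
    also have "\<dots> = (\<Sum>a\<in>(\<lambda>a. r - a) ` ?S. gcoeff g a * gcoeff f (r - a))"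
      by (subst sum.reindex) (auto simp: inj_on_def mult.commute)
    also have "\<dots> = gcoeff (g * f) r"
      by (rule gcoeff_mult[symmetric], simp add: finite_mult_support)
        (rule image_eqI[of _ _ "r - a" for a], auto)
    finally show "gcoeff (f * g) r = gcoeff (g * f) r" .
  qed
  show "(f + g) * h = f * h + g * h"
  proof (rule gps_eqI)
    fix r
    let ?S = "{a. gcoeff f a \<noteq> 0 \<and> gcoeff h (r - a) \<noteq> 0} \<union> {a. gcoeff g a \<noteq> 0 \<and> gcoeff h (r - a) \<noteq> 0}"
    have S: "finite ?S" by (simp add: finite_mult_support)
    show "gcoeff ((f + g) * h) r = gcoeff (f * h + g * h) r"
      by (simp, (subst gcoeff_mult[OF S], force)+) (simp add: algebra_simps sum.distrib)
  qed
  show "f * g * h = f * (g * h)"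
  proof (rule gps_eqI)
    fix r
    obtain mf mg mh where mf: "vanishes_below mf f" and mg: "vanishes_below mg g" and mh: "vanishes_below mh h"
      using ex_vanishes_below by metis
    \<comment> \<open>Whenever a triple product of coefficients contributes to exponent
      \<open>r\<close>, the lower bounds on the other two orders bound each exponent from above.
      Thus one finite set per factor, independent of the intermediate exponent, serves for both
      bracketings.\<close>
    define F where "F = {a. gcoeff f a \<noteq> 0 \<and> a \<le> r - mg - mh}"
    define G where "G = {a. gcoeff g a \<noteq> 0 \<and> a \<le> r - mf - mh}"
    define U where "U = (\<lambda>(a,b). a + b) ` (F \<times> G)"
    have fin: "finite F" "finite G" "finite U" by (simp_all add: F_def G_def U_def finite_gcoeff)
    have "gcoeff (f * g * h) r = (\<Sum>u\<in>U. gcoeff (f * g) u * gcoeff h (r - u))"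
    proof (rule gcoeff_mult)
      fix u assume u: "gcoeff (f * g) u \<noteq> 0" "gcoeff h (r - u) \<noteq> 0"
      obtain a where a: "gcoeff f a \<noteq> 0" "gcoeff g (u - a) \<noteq> 0" using u gcoeff_mult_nonzeroD by blast
      from a u have "mf \<le> a" "mg \<le> u - a" "mh \<le> r - u" using mf mg mh vanishes_belowD by auto
      with a show "u \<in> U" unfolding U_def F_def G_def by (intro image_eqI[of _ _ "(a, u - a)"]) auto
    qed (rule fin)
    also have "\<dots> = (\<Sum>u\<in>U. \<Sum>a\<in>F. gcoeff f a * (gcoeff g (u - a) * gcoeff h (r - u)))"
    proof (rule sum.cong)
      fix u
      show "gcoeff (f * g) u * gcoeff h (r - u)
          = (\<Sum>a\<in>F. gcoeff f a * (gcoeff g (u - a) * gcoeff h (r - u)))"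
      proof (cases "gcoeff h (r - u) = 0")
        case False
        then have "mh \<le> r - u" using mh vanishes_belowD by auto
        then have "gcoeff (f * g) u = (\<Sum>a\<in>F. gcoeff f a * gcoeff g (u - a))"
          using mg by (intro gcoeff_mult) (use fin in \<open>force simp: F_def dest: vanishes_belowD\<close>)+
        then show ?thesis by (simp add: sum_distrib_right mult.assoc)
      qed simp
    qed simp
    also have "\<dots> = (\<Sum>a\<in>F. gcoeff f a * (\<Sum>u\<in>U. gcoeff g (u - a) * gcoeff h (r - u)))"
      by (subst sum.swap) (simp add: sum_distrib_left)
    also have "\<dots> = (\<Sum>a\<in>F. gcoeff f a * gcoeff (g * h) (r - a))"
    proof (rule sum.cong)
      fix a assume a: "a \<in> F"
      have "(\<Sum>u\<in>U. gcoeff g (u - a) * gcoeff h (r - u))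
          = (\<Sum>b\<in>(\<lambda>u. u - a) ` U. gcoeff g b * gcoeff h (r - a - b))"
        by (subst sum.reindex) (auto simp: inj_on_def)
      also have "\<dots> = gcoeff (g * h) (r - a)"
      proof (rule gcoeff_mult[symmetric])
        fix b assume b: "gcoeff g b \<noteq> 0" "gcoeff h (r - a - b) \<noteq> 0"
        have "mf \<le> a" "mh \<le> r - a - b" using a b mf mh vanishes_belowD by (auto simp: F_def)
        then have "b \<in> G" using b by (simp add: G_def)
        then have "a + b \<in> U" using a by (force simp: U_def)
        then show "b \<in> (\<lambda>u. u - a) ` U" by force
      qed (use fin in simp)
      finally show "gcoeff f a * (\<Sum>u\<in>U. gcoeff g (u - a) * gcoeff h (r - u))
          = gcoeff f a * gcoeff (g * h) (r - a)" by simp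
    qed simp
    also have "\<dots> = gcoeff (f * (g * h)) r"
    proof (rule gcoeff_mult[symmetric])
      fix a assume a: "gcoeff f a \<noteq> 0" "gcoeff (g * h) (r - a) \<noteq> 0"
      obtain b where b: "gcoeff g b \<noteq> 0" "gcoeff h (r - a - b) \<noteq> 0" using a gcoeff_mult_nonzeroD by blast
      then have "mg \<le> b" "mh \<le> r - a - b" using mg mh vanishes_belowD by auto
      with a show "a \<in> F" by (simp add: F_def)
    qed (rule fin)
    finally show "gcoeff (f * g * h) r = gcoeff (f * (g * h)) r" .
  qed
qed

end

lemma gcoeff_1: "gcoeff 1 a = (if a = 0 then 1 else 0)"
  by (simp add: one_gps_def gcoeff_gmonom)

lemma gcoeff_sum [simp]: "gcoeff (sum F S) a = (\<Sum>i\<in>S. gcoeff (F i) a)"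
  by (induction S rule: infinite_finite_induct) auto

lemma gmonom_mult_gmonom: "gmonom c m * gmonom d n = gmonom (c * d) (m + n)"
  by (rule gps_eqI) (auto simp: gcoeff_gmonom_mult gcoeff_gmonom)

lemma gmonom_1_0 [simp]: "gmonom 1 0 = 1"
  by (simp add: one_gps_def)

lemma gmonom_power: "gmonom c m ^ n = gmonom (c ^ n) (of_nat n * m)"
  by (induction n) (auto simp: gmonom_mult_gmonom algebra_simps)

section \<open>Arithmetic of orders\<close>

lemma vanishes_below_0 [simp]: "vanishes_below m 0"
  by (simp add: vanishes_below_def)

lemma vanishes_below_1: "vanishes_below 0 1"
  by (simp add: vanishes_below_def gcoeff_1)

lemma vanishes_below_gmonom: "vanishes_below m (gmonom c m)"
  by (simp add: vanishes_below_def gcoeff_gmonom)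

lemma vanishes_below_add: "vanishes_below m f \<Longrightarrow> vanishes_below m g \<Longrightarrow> vanishes_below m (f + g)"
  by (simp add: vanishes_below_def)

lemma vanishes_below_diff: "vanishes_below m f \<Longrightarrow> vanishes_below m g \<Longrightarrow> vanishes_below m (f - g)"
  by (simp add: vanishes_below_def)

lemma vanishes_below_uminus: "vanishes_below m f \<Longrightarrow> vanishes_below m (- f)"
  by (simp add: vanishes_below_def)

lemma vanishes_below_sum: "(\<And>i. i \<in> S \<Longrightarrow> vanishes_below m (F i)) \<Longrightarrow> vanishes_below m (sum F S)"
  by (simp add: vanishes_below_def)

lemma vanishes_below_mult:
  assumes "vanishes_below m f" "vanishes_below n g"
  shows "vanishes_below (m + n) (f * g)"
  unfolding vanishes_below_def
proof (intro allI impI)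
  fix a assume "a < m + n"
  then show "gcoeff (f * g) a = 0"
    using gcoeff_mult_nonzeroD[of f g a] vanishes_belowD[OF assms(1)] vanishes_belowD[OF assms(2)]
    by (smt (verit))
qed

lemma vanishes_below_power: "vanishes_below m f \<Longrightarrow> vanishes_below (of_nat n * m) (f ^ n)"
  by (induction n) (auto simp: vanishes_below_1 algebra_simps dest: vanishes_below_mult)

lemma gcoeff_mult_leading:
  assumes "vanishes_below m f" "vanishes_below n g"
  shows "gcoeff (f * g) (m + n) = gcoeff f m * gcoeff g n"
proof -
  have "gcoeff (f * g) (m + n) = (\<Sum>a\<in>{m}. gcoeff f a * gcoeff g (m + n - a))"
    by (rule gcoeff_mult)
      (use vanishes_belowD[OF assms(1)] vanishes_belowD[OF assms(2)] in \<open>force+\<close>)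
  then show ?thesis by simp
qed

lemma gps_nonzero_leading:
  assumes "f \<noteq> 0"
  obtains m where "gcoeff f m \<noteq> 0" "vanishes_below m f"
  using assms leading_exponent by (metis gcoeff_0 gps_eqI)

instance gps :: idom
proof
  fix f g :: gps
  assume "f \<noteq> 0" "g \<noteq> 0"
  then obtain m n where "gcoeff f m \<noteq> 0" "vanishes_below m f" "gcoeff g n \<noteq> 0" "vanishes_below n g"
    using gps_nonzero_leading by metis
  then have "gcoeff (f * g) (m + n) \<noteq> 0" by (simp add: gcoeff_mult_leading)
  then show "f * g \<noteq> 0" by auto
qed

text \<open>Leading coefficients multiply without cancellation, so the order of a product is the sum
  of the orders and a factor of known order can be divided out.\<close>

lemma vanishes_below_cancel:
  assumes "vanishes_below m f" "gcoeff f m \<noteq> 0" "vanishes_below (m + n) (f * g)"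
  shows "vanishes_below n g"
proof (cases "g = 0")
  case False
  then obtain k where k: "gcoeff g k \<noteq> 0" "vanishes_below k g" using gps_nonzero_leading by blast
  then have "gcoeff (f * g) (m + k) \<noteq> 0" using assms by (simp add: gcoeff_mult_leading)
  then have "n \<le> k" using vanishes_belowD[OF assms(3)] by force
  then show ?thesis using k vanishes_below_mono by blast
qed simp

text \<open>The support has no accumulation point, so an order above \<open>m\<close> exceeds it by
  a definite gap. Every \<open>\<epsilon>\<close> below originates here.\<close>

lemma ex_vanishes_below_next:
  assumes "vanishes_below m f" "gcoeff f m = 0"
  shows "\<exists>\<epsilon>>0. vanishes_below (m + \<epsilon>) f"
proof (cases "f = 0")
  case False
  then obtain k where k: "gcoeff f k \<noteq> 0" "vanishes_below k f" using gps_nonzero_leading by blast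
  then have "m < k" using assms vanishes_belowD[of m f k] by (cases "m = k") auto
  then show ?thesis using k by (intro exI[of _ "k - m"]) auto
qed (auto intro: exI[of _ 1])

text \<open>For \<open>l\<close> the identity this is \<open>x d/dx\<close>.\<close>

definition gdiff :: "(real \<Rightarrow> real) \<Rightarrow> gps \<Rightarrow> gps" where
  "gdiff l f = Abs_gps (\<lambda>a. of_real (l a) * gcoeff f a)"

lemma gcoeff_gdiff: "gcoeff (gdiff l f) a = of_real (l a) * gcoeff f a"
  unfolding gdiff_def by (subst gcoeff_Abs_support[of f f]) simp_all

lemma gdiff_add: "gdiff l (f + g) = gdiff l f + gdiff l g"
  by (rule gps_eqI) (simp add: gcoeff_gdiff algebra_simps)

text \<open>Additivity of \<open>l\<close> on exponents is exactly the Leibniz rule on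
  monomials.\<close>

lemma gdiff_mult:
  assumes "\<And>a b. l (a + b) = l a + l b"
  shows "gdiff l (f * g) = gdiff l f * g + f * gdiff l g"
proof (rule gps_eqI)
  fix r
  let ?S = "{a. gcoeff f a \<noteq> 0 \<and> gcoeff g (r - a) \<noteq> 0}"
  note S = finite_mult_support[of f g r]
  have l: "l r = l a + l (r - a)" for a
    using assms[of a "r - a"] by simp
  have "gcoeff (f * g) r = (\<Sum>a\<in>?S. gcoeff f a * gcoeff g (r - a))"
    by (rule gcoeff_mult[OF S]) simp
  then have "gcoeff (gdiff l (f * g)) r = (\<Sum>a\<in>?S. of_real (l r) * (gcoeff f a * gcoeff g (r - a)))"
    by (simp only: gcoeff_gdiff sum_distrib_left)
  also have "\<dots> = (\<Sum>a\<in>?S. of_real (l a) * (gcoeff f a * gcoeff g (r - a)))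
      + (\<Sum>a\<in>?S. of_real (l (r - a)) * (gcoeff f a * gcoeff g (r - a)))"
    unfolding sum.distrib[symmetric]
  proof (rule sum.cong[OF refl])
    fix a
    show "of_real (l r) * (gcoeff f a * gcoeff g (r - a)) = of_real (l a) * (gcoeff f a * gcoeff g (r - a))
        + of_real (l (r - a)) * (gcoeff f a * gcoeff g (r - a))"
      unfolding distrib_right[symmetric] of_real_add[symmetric] using l[of a] by simp
  qed
  also have "(\<Sum>a\<in>?S. of_real (l a) * (gcoeff f a * gcoeff g (r - a))) = gcoeff (gdiff l f * g) r"
    by (subst gcoeff_mult[OF S]) (simp_all add: gcoeff_gdiff mult_ac)
  also have "(\<Sum>a\<in>?S. of_real (l (r - a)) * (gcoeff f a * gcoeff g (r - a))) = gcoeff (f * gdiff l g) r"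
    by (subst gcoeff_mult[OF S]) (simp_all add: gcoeff_gdiff mult_ac)
  finally show "gcoeff (gdiff l (f * g)) r = gcoeff (gdiff l f * g + f * gdiff l g) r"
    by simp
qed

definition gderiv :: "gps \<Rightarrow> gps" where
  "gderiv f = gmonom 1 (-1) * gdiff (\<lambda>a. a) f"

lemma gcoeff_gderiv: "gcoeff (gderiv f) a = of_real (a + 1) * gcoeff f (a + 1)"
  by (simp add: gderiv_def gcoeff_gmonom_mult gcoeff_gdiff)

lemma gs_deriv_gcoeff: "gs_deriv (gcoeff f) = gcoeff (gderiv f)"
  by (auto simp: gs_deriv_def gcoeff_gderiv)

lemma gderiv_add: "gderiv (f + g) = gderiv f + gderiv g"
  by (simp add: gderiv_def gdiff_add algebra_simps)

lemma gderiv_mult: "gderiv (f * g) = gderiv f * g + f * gderiv g"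
  by (simp add: gderiv_def gdiff_mult algebra_simps)

text \<open>\<open>d/dx\<close> shifts exponents by 1, and \<open>l\<close> does not see this shift
  because \<open>l 1 = 0\<close>.\<close>

lemma gdiff_gderiv:
  assumes "\<And>a b. l (a + b) = l a + l b" "l 1 = 0"
  shows "gdiff l (gderiv f) = gderiv (gdiff l f)"
  by (rule gps_eqI) (simp add: gcoeff_gdiff gcoeff_gderiv assms)

lemma vanishes_below_gdiff: "vanishes_below m f \<Longrightarrow> vanishes_below m (gdiff l f)"
  by (simp add: vanishes_below_def gcoeff_gdiff)

lemma vanishes_below_gderiv: "vanishes_below m f \<Longrightarrow> vanishes_below (m - 1) (gderiv f)"
  by (simp add: vanishes_below_def gcoeff_gderiv)

subsection \<open>Taylor expansion of a bivariate polynomial\<close>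

text \<open>The partial derivative of order \<open>(k, l)\<close> divided by \<open>k! l!\<close>,
  taken at \<open>(s, u)\<close>, of the polynomial with coefficients \<open>c i j\<close>. Index
  \<open>(0, 0)\<close> gives the value, \<open>(1, 0)\<close> and \<open>(0, 1)\<close> the two
  partial derivatives. The truncated subtraction in the exponents is harmless: where it cuts off,
  the binomial coefficient is 0.\<close>

definition taylor :: "(nat \<Rightarrow> nat \<Rightarrow> complex) \<Rightarrow> nat \<Rightarrow> nat \<Rightarrow> nat \<Rightarrow> gps \<Rightarrow> gps \<Rightarrow> gps" where
  "taylor c n k l s u = (\<Sum>i\<le>n. \<Sum>j\<le>n.
     gmonom (c i j) 0 * (of_nat (i choose k) * s ^ (i - k)) * (of_nat (j choose l) * u ^ (j - l)))"

lemma gmonom_add: "gmonom c m + gmonom d m = gmonom (c + d) m"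
  by (rule gps_eqI) (simp add: gcoeff_gmonom)

lemma gmonom_eq_0_iff [simp]: "gmonom c m = 0 \<longleftrightarrow> c = 0"
  by (metis gcoeff_0 gcoeff_gmonom gps_eqI)

lemma gmonom_0 [simp]: "gmonom 0 m = 0"
  by simp

lemma of_nat_gps: "of_nat n = gmonom (of_nat n) 0"
proof (induction n)
  case 0
  then show ?case by (intro gps_eqI) (simp add: gcoeff_gmonom)
next
  case (Suc n)
  have "(of_nat (Suc n) :: gps) = gmonom (of_nat n) 0 + gmonom 1 0" using Suc by simp
  then show ?case by (simp only: gmonom_add) (simp add: add.commute)
qed

text \<open>The upper limit \<open>n\<close> does not depend on \<open>i\<close>, which allows the
  later interchange of sums.\<close>

lemma binomial_upto:
  fixes s a :: gps
  assumes "i \<le> n"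
  shows "(s + a) ^ i = (\<Sum>k\<le>n. of_nat (i choose k) * s ^ (i - k) * a ^ k)"
proof -
  have "(s + a) ^ i = (\<Sum>k\<le>i. of_nat (i choose k) * a ^ k * s ^ (i - k))"
    using binomial_ring[of a s i] by (simp add: add.commute)
  also have "\<dots> = (\<Sum>k\<le>n. of_nat (i choose k) * a ^ k * s ^ (i - k))"
  proof (rule sum.mono_neutral_left)
    show "\<forall>k\<in>{..n} - {..i}. of_nat (i choose k) * a ^ k * s ^ (i - k) = 0"
    proof
      fix k assume "k \<in> {..n} - {..i}"
      then have "i choose k = 0" by (simp add: binomial_eq_0)
      then show "of_nat (i choose k) * a ^ k * s ^ (i - k) = 0"
        by (simp only: of_nat_0 mult_zero_left)
    qed
  qed (use assms in auto)
  finally show ?thesis by (simp add: mult_ac)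
qed

lemma taylor_expansion:
  "taylor c n 0 0 (s + a) (u + b) = (\<Sum>k\<le>n. \<Sum>l\<le>n. taylor c n k l s u * (a ^ k * b ^ l))"
proof -
  define S where "S i k = of_nat (i choose k) * s ^ (i - k)" for i k
  define U where "U j l = of_nat (j choose l) * u ^ (j - l)" for j l
  have "taylor c n 0 0 (s + a) (u + b) = (\<Sum>i\<le>n. \<Sum>j\<le>n. gmonom (c i j) 0 * (s + a) ^ i * (u + b) ^ j)"
    by (simp add: taylor_def)
  also have "\<dots> = (\<Sum>i\<le>n. \<Sum>j\<le>n. gmonom (c i j) 0 * (\<Sum>k\<le>n. S i k * a ^ k) * (\<Sum>l\<le>n. U j l * b ^ l))"
    by (intro sum.cong refl) (simp add: binomial_upto[of _ n] S_def U_def)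
  also have "\<dots> = (\<Sum>i\<le>n. \<Sum>j\<le>n. \<Sum>k\<le>n. \<Sum>l\<le>n. gmonom (c i j) 0 * S i k * U j l * (a ^ k * b ^ l))"
    by (simp add: sum_distrib_left sum_distrib_right mult_ac)
  also have "\<dots> = (\<Sum>i\<le>n. \<Sum>k\<le>n. \<Sum>l\<le>n. \<Sum>j\<le>n. gmonom (c i j) 0 * S i k * U j l * (a ^ k * b ^ l))"
    by (rule sum.cong[OF refl], subst sum.swap, rule sum.cong[OF refl], rule sum.swap)
  also have "\<dots> = (\<Sum>k\<le>n. \<Sum>l\<le>n. \<Sum>i\<le>n. \<Sum>j\<le>n. gmonom (c i j) 0 * S i k * U j l * (a ^ k * b ^ l))"
    by (subst sum.swap, rule sum.cong[OF refl], rule sum.swap)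
  also have "\<dots> = (\<Sum>k\<le>n. \<Sum>l\<le>n. taylor c n k l s u * (a ^ k * b ^ l))"
    by (simp add: taylor_def S_def U_def sum_distrib_right)
  finally show ?thesis .
qed

text \<open>The chain rule for an abstract derivation that kills constants; it serves both
  \<open>d/dx\<close> and the derivation coming from a linear functional.\<close>

lemma derivation_taylor:
  assumes add: "\<And>f g. D (f + g) = D f + D g"
    and mult: "\<And>f g. D (f * g) = D f * g + f * D g"
    and const: "\<And>c. D (gmonom c 0) = 0"
  shows "D (taylor c n 0 0 s u) = taylor c n 1 0 s u * D s + taylor c n 0 1 s u * D u"
proof -
  have "D 0 = D 0 + D 0" using add[of 0 0] by (simp only: add_0_left)
  then have zero: "D 0 = 0" by (metis add_cancel_right_right)
  have one: "D 1 = 0" using const[of 1] by simp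
  have sum: "D (sum F S) = (\<Sum>i\<in>S. D (F i))" for F :: "nat \<Rightarrow> gps" and S
    by (induction S rule: infinite_finite_induct) (simp_all add: zero add)
  have pow: "D (f ^ i) = of_nat i * f ^ (i - 1) * D f" for f i
  proof (induction i)
    case (Suc i)
    then show ?case by (cases i) (simp_all add: one mult algebra_simps)
  qed (simp add: one)
  show ?thesis
    by (simp add: taylor_def sum mult pow const sum.distrib[symmetric] sum_distrib_right)
      (intro sum.cong refl, simp add: algebra_simps)
qed

lemma gderiv_gmonom_0: "gderiv (gmonom c 0) = 0"
  by (rule gps_eqI) (simp add: gcoeff_gderiv gcoeff_gmonom del: of_real_add)

lemma gderiv_taylor:
  "gderiv (taylor c n 0 0 s u) = taylor c n 1 0 s u * gderiv s + taylor c n 0 1 s u * gderiv u"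
  by (rule derivation_taylor) (simp_all add: gderiv_add gderiv_mult gderiv_gmonom_0)

lemma gdiff_taylor:
  assumes "\<And>a b. l (a + b) = l a + l b"
  shows "gdiff l (taylor c n 0 0 s u) = taylor c n 1 0 s u * gdiff l s + taylor c n 0 1 s u * gdiff l u"
proof (rule derivation_taylor)
  have "l 0 = 0" using assms[of 0 0] by simp
  then show "gdiff l (gmonom c 0) = 0" for c by (intro gps_eqI) (simp add: gcoeff_gdiff gcoeff_gmonom)
qed (simp_all add: gdiff_add gdiff_mult assms)

text \<open>Differentiating the relation \<open>q(s) = 0\<close> gives \<open>q'(s) s' = 0\<close>.
  In an integral domain of characteristic 0 either \<open>s' = 0\<close> or \<open>s\<close>
  satisfies a relation of smaller degree, still with nonzero leading coefficient; degree 0 is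
  absurd.\<close>

lemma gderiv_eq_0_if_algebraic:
  assumes "(\<Sum>i\<le>d. gmonom (q i) 0 * s ^ i) = 0" "q d \<noteq> 0"
  shows "gderiv s = 0"
  using assms
proof (induction d arbitrary: q)
  case 0
  then show ?case by simp
next
  case (Suc d)
  have zero: "gderiv 0 = 0" by (rule gps_eqI) (simp add: gcoeff_gderiv)
  have sum: "gderiv (sum F S) = (\<Sum>i\<in>S. gderiv (F i))" for F :: "nat \<Rightarrow> gps" and S
    by (induction S rule: infinite_finite_induct) (simp_all add: zero gderiv_add)
  have pow: "gderiv (s ^ Suc i) = of_nat (Suc i) * s ^ i * gderiv s" for i
    by (induction i) (simp_all add: gderiv_mult algebra_simps)
  have "0 = gderiv (\<Sum>i\<le>Suc d. gmonom (q i) 0 * s ^ i)" by (simp only: Suc.prems zero)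
  also have "\<dots> = gderiv (gmonom (q 0) 0) + (\<Sum>i\<le>d. gderiv (gmonom (q (Suc i)) 0 * s ^ Suc i))"
    by (subst sum.atMost_Suc_shift) (simp only: gderiv_add sum power_0 mult_1_right)
  also have "\<dots> = (\<Sum>i\<le>d. gmonom (q (Suc i) * of_nat (Suc i)) 0 * s ^ i) * gderiv s"
    by (simp add: gderiv_gmonom_0 gderiv_mult pow sum_distrib_right of_nat_gps[of "Suc _"] gmonom_mult_gmonom
        mult.assoc[symmetric] del: power_Suc of_nat_Suc)
  finally have "(\<Sum>i\<le>d. gmonom (q (Suc i) * of_nat (Suc i)) 0 * s ^ i) = 0 \<or> gderiv s = 0"
    by simp
  then show ?case using Suc.IH[of "\<lambda>i. q (Suc i) * of_nat (Suc i)"] Suc.prems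
    by (auto simp del: of_nat_Suc)
qed

text \<open>As long as the partial derivative in the second variable vanishes at
  \<open>(s, u)\<close>, it replaces the polynomial and lowers the degree in that variable. The
  descent cannot reach degree 0, where it would leave an algebraic equation with constant
  coefficients for the nonconstant \<open>s\<close>.\<close>

lemma ex_nondegenerate:
  assumes "\<exists>i j. i \<le> n \<and> c i j \<noteq> 0" "\<And>i j. i \<le> n \<Longrightarrow> d < j \<Longrightarrow> c i j = 0" "d \<le> n"
    and "taylor c n 0 0 s u = 0" "gderiv s \<noteq> 0"
  shows "\<exists>c'. taylor c' n 0 0 s u = 0 \<and> taylor c' n 0 1 s u \<noteq> 0"
  using assms(1-4)
proof (induction d arbitrary: c)
  case 0
  have "taylor c n 0 0 s u = (\<Sum>i\<le>n. \<Sum>j\<in>{0}. gmonom (c i j) 0 * s ^ i * u ^ j)"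
    unfolding taylor_def
    by (rule sum.cong[OF refl], rule sum.mono_neutral_cong_right)
      (simp_all add: "0.prems"(2))
  then have eq: "(\<Sum>i\<le>n. gmonom (c i 0) 0 * s ^ i) = 0" using "0.prems" by simp
  obtain i where i: "i \<le> n" "c i 0 \<noteq> 0" using "0.prems"(1,2) by (metis gr0I)
  \<comment> \<open>The last nonzero coefficient must be found first, since the algebraic relation
    has to have a nonzero leading coefficient.\<close>
  define I where "I = Max {i. i \<le> n \<and> c i 0 \<noteq> 0}"
  have fin: "finite {i. i \<le> n \<and> c i 0 \<noteq> 0}" by simp
  have "I \<in> {i. i \<le> n \<and> c i 0 \<noteq> 0}" unfolding I_def using i by (intro Max_in[OF fin]) blast
  then have I: "I \<le> n" "c I 0 \<noteq> 0" by simp_all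
  have "c k 0 = 0" if "k \<le> n" "I < k" for k
  proof (rule ccontr)
    assume "c k 0 \<noteq> 0"
    then have "k \<le> I" unfolding I_def using that(1) by (intro Max_ge[OF fin]) simp
    with that show False by simp
  qed
  then have "(\<Sum>i\<le>n. gmonom (c i 0) 0 * s ^ i) = (\<Sum>i\<le>I. gmonom (c i 0) 0 * s ^ i)"
    using I by (intro sum.mono_neutral_right) auto
  with eq have "gderiv s = 0" using I(2) by (intro gderiv_eq_0_if_algebraic[of "\<lambda>i. c i 0" s I]) simp_all
  with assms(5) show ?case by simp
next
  case (Suc d)
  \<comment> \<open>The coefficients of the partial derivative in the second variable.\<close>
  define c' where "c' i j = of_nat (Suc j) * c i (Suc j)" for i j
  have "taylor c n 0 1 s u = taylor c' n 0 0 s u"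
  proof -
    obtain m where m: "n = Suc m" using Suc.prems(3) by (cases n) auto
    have c'0: "c' i (Suc m) = 0" if "i \<le> n" for i using that Suc.prems(2,3) m by (simp add: c'_def)

    have "(\<Sum>j\<le>n. gmonom (c i j) 0 * (of_nat (i choose 0) * s ^ (i - 0)) * (of_nat (j choose 1) * u ^ (j - 1)))
       = (\<Sum>j\<le>n. gmonom (c' i j) 0 * (of_nat (i choose 0) * s ^ (i - 0)) * (of_nat (j choose 0) * u ^ (j - 0)))" if "i \<le> n" for i
    proof -
      have "(\<Sum>j\<le>n. gmonom (c i j) 0 * (of_nat (i choose 0) * s ^ (i - 0)) * (of_nat (j choose 1) * u ^ (j - 1)))
        = (\<Sum>j\<le>m. gmonom (c i (Suc j)) 0 * s ^ i * (of_nat (Suc j) * u ^ j))"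
        unfolding m by (subst sum.atMost_Suc_shift) simp
      also have "\<dots> = (\<Sum>j\<le>m. gmonom (c' i j) 0 * s ^ i * u ^ j)"
        by (intro sum.cong refl)
          (simp add: c'_def of_nat_gps[of "Suc _"] gmonom_mult_gmonom mult_ac
            flip: gmonom_mult_gmonom[of _ 0 _ 0, simplified] del: of_nat_Suc)
      also have "\<dots> = (\<Sum>j\<le>n. gmonom (c' i j) 0 * (of_nat (i choose 0) * s ^ (i - 0)) * (of_nat (j choose 0) * u ^ (j - 0)))"
        using c'0[OF that] unfolding m by simp
      finally show ?thesis .
    qed
    then show ?thesis unfolding taylor_def by simp
  qed
  note c' = this
  show ?case
  proof (cases "taylor c n 0 1 s u = 0")
    case True
    show ?thesis
    proof (cases "\<exists>i j. i \<le> n \<and> c i (Suc j) \<noteq> 0")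
      case True
      then have "\<exists>i j. i \<le> n \<and> c' i j \<noteq> 0" by (auto simp: c'_def simp del: of_nat_Suc)
      moreover have "c' i j = 0" if "i \<le> n" "d < j" for i j
        using Suc.prems(2) that by (simp add: c'_def)
      ultimately show ?thesis
        using Suc.IH[of c'] Suc.prems(3) \<open>taylor c n 0 1 s u = 0\<close> c' by simp
    next
      case False
      have "c i j = 0" if "i \<le> n" "d < j" for i j
        using False that by (metis gr_implies_not0 not0_implies_Suc)
      then show ?thesis using Suc.IH[of c] Suc.prems by simp
    qed
  qed (use Suc.prems in blast)
qed

subsection \<open>The equation satisfied by the tail of a solution\<close>

definition supp_in :: "real set \<Rightarrow> gps \<Rightarrow> bool" where
  "supp_in \<Gamma> f \<longleftrightarrow> (\<forall>a. gcoeff f a \<noteq> 0 \<longrightarrow> a \<in> \<Gamma>)"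

definition fin_supp :: "gps \<Rightarrow> bool" where
  "fin_supp f \<longleftrightarrow> finite {a. gcoeff f a \<noteq> 0}"

definition add_closed :: "real set \<Rightarrow> bool" where
  "add_closed \<Gamma> \<longleftrightarrow> 0 \<in> \<Gamma> \<and> (\<forall>a\<in>\<Gamma>. \<forall>b\<in>\<Gamma>. a + b \<in> \<Gamma>)"

lemma supp_in_gmonom: "m \<in> \<Gamma> \<Longrightarrow> supp_in \<Gamma> (gmonom c m)"
  by (simp add: supp_in_def gcoeff_gmonom)

lemma supp_in_add: "supp_in \<Gamma> f \<Longrightarrow> supp_in \<Gamma> g \<Longrightarrow> supp_in \<Gamma> (f + g)"
  unfolding supp_in_def by (metis gcoeff_add add.right_neutral)

lemma supp_in_sum: "(\<And>i. i \<in> S \<Longrightarrow> supp_in \<Gamma> (F i)) \<Longrightarrow> supp_in \<Gamma> (sum F S)"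
  by (induction S rule: infinite_finite_induct) (auto simp: supp_in_add, auto simp: supp_in_def)

lemma supp_in_mult: "add_closed \<Gamma> \<Longrightarrow> supp_in \<Gamma> f \<Longrightarrow> supp_in \<Gamma> g \<Longrightarrow> supp_in \<Gamma> (f * g)"
  unfolding supp_in_def add_closed_def
  by (metis gcoeff_mult_nonzeroD add.commute diff_add_cancel)

lemma supp_in_1: "add_closed \<Gamma> \<Longrightarrow> supp_in \<Gamma> 1"
  by (simp add: supp_in_def gcoeff_1 add_closed_def)

lemma supp_in_power: "add_closed \<Gamma> \<Longrightarrow> supp_in \<Gamma> f \<Longrightarrow> supp_in \<Gamma> (f ^ n)"
  by (induction n) (simp_all add: supp_in_mult supp_in_1)

lemma supp_in_of_nat: "add_closed \<Gamma> \<Longrightarrow> supp_in \<Gamma> (of_nat n)"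
  by (simp add: of_nat_gps supp_in_gmonom add_closed_def)

lemma supp_in_taylor:
  assumes "add_closed \<Gamma>" "supp_in \<Gamma> s" "supp_in \<Gamma> u"
  shows "supp_in \<Gamma> (taylor c n k l s u)"
  unfolding taylor_def using assms
  by (intro supp_in_sum supp_in_mult supp_in_gmonom supp_in_power supp_in_of_nat) (auto simp: add_closed_def)

lemma supp_in_gderiv:
  assumes "add_closed \<Gamma>" "-1 \<in> \<Gamma>" "supp_in \<Gamma> f"
  shows "supp_in \<Gamma> (gderiv f)"
  unfolding supp_in_def
proof (intro allI impI)
  fix a assume "gcoeff (gderiv f) a \<noteq> 0"
  then have "a + 1 \<in> \<Gamma>" using assms(3) by (simp add: gcoeff_gderiv supp_in_def)
  then have "(a + 1) + (-1) \<in> \<Gamma>" using assms(1,2) unfolding add_closed_def by blast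
  then show "a \<in> \<Gamma>" by simp
qed

lemma fin_supp_iff: "fin_supp f \<longleftrightarrow> (\<exists>F. finite F \<and> supp_in F f)"
  unfolding fin_supp_def supp_in_def by (auto intro: finite_subset)

lemma fin_supp_gmonom: "fin_supp (gmonom c m)"
  unfolding fin_supp_iff by (rule exI[of _ "{m}"]) (simp add: supp_in_gmonom)

lemma fin_supp_add: "fin_supp f \<Longrightarrow> fin_supp g \<Longrightarrow> fin_supp (f + g)"
  unfolding fin_supp_def
  by (rule finite_subset[of _ "{a. gcoeff f a \<noteq> 0} \<union> {a. gcoeff g a \<noteq> 0}"]) auto

lemma fin_supp_0: "fin_supp 0"
  by (simp add: fin_supp_def)

lemma fin_supp_sum: "(\<And>i. i \<in> S \<Longrightarrow> fin_supp (F i)) \<Longrightarrow> fin_supp (sum F S)"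
  by (induction S rule: infinite_finite_induct) (auto simp: fin_supp_add fin_supp_0)

lemma fin_supp_mult: "fin_supp f \<Longrightarrow> fin_supp g \<Longrightarrow> fin_supp (f * g)"
proof -
  assume "fin_supp f" "fin_supp g"
  then have fin: "finite ((\<lambda>(a, b). a + b) ` ({a. gcoeff f a \<noteq> 0} \<times> {a. gcoeff g a \<noteq> 0}))" (is "finite ?F")
    by (simp add: fin_supp_def)
  have "supp_in ?F (f * g)"
    unfolding supp_in_def
  proof (intro allI impI)
    fix r assume "gcoeff (f * g) r \<noteq> 0"
    then obtain a where "gcoeff f a \<noteq> 0" "gcoeff g (r - a) \<noteq> 0" by (rule gcoeff_mult_nonzeroD)
    then show "r \<in> ?F" by (intro image_eqI[of _ _ "(a, r - a)"]) simp_all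
  qed
  with fin show "fin_supp (f * g)" unfolding fin_supp_iff by blast
qed

lemma fin_supp_power: "fin_supp f \<Longrightarrow> fin_supp (f ^ n)"
proof (induction n)
  case 0
  then show ?case using fin_supp_gmonom[of 1 0] by simp
qed (simp add: fin_supp_mult)

lemma fin_supp_taylor: "fin_supp s \<Longrightarrow> fin_supp u \<Longrightarrow> fin_supp (taylor c n k l s u)"
  unfolding taylor_def
  by (intro fin_supp_sum fin_supp_mult fin_supp_gmonom fin_supp_power) (simp_all add: of_nat_gps fin_supp_gmonom)

lemma fin_supp_gderiv: "fin_supp f \<Longrightarrow> fin_supp (gderiv f)"
proof -
  assume "fin_supp f"
  then have "finite {a. gcoeff (gdiff (\<lambda>a. a) f) a \<noteq> 0}"
    unfolding fin_supp_def by (rule rev_finite_subset) (auto simp: gcoeff_gdiff)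
  then show ?thesis unfolding gderiv_def
    by (intro fin_supp_mult fin_supp_gmonom) (simp add: fin_supp_def)
qed

section \<open>Order estimates for Taylor coefficients\<close>

lemma vanishes_below_of_nat: "vanishes_below 0 (of_nat n)"
  by (simp add: of_nat_gps vanishes_below_gmonom)

text \<open>Since \<open>m \<le> 0\<close>, high powers are the worst case. This gives one crude
  bound valid for all Taylor coefficients.\<close>

lemma vanishes_below_taylor_term:
  assumes "vanishes_below m f" "vanishes_below m g" "m \<le> 0" "i \<le> n" "j \<le> n"
  shows "vanishes_below (2 * of_nat n * m) (f ^ i * g ^ j)"
proof -
  have "vanishes_below (of_nat i * m + of_nat j * m) (f ^ i * g ^ j)"
    using assms by (intro vanishes_below_mult vanishes_below_power)
  moreover have "of_nat n * m \<le> of_nat i * m" "of_nat n * m \<le> of_nat j * m"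
    using assms by (intro mult_right_mono_neg; simp)+
  ultimately show ?thesis by (auto elim!: vanishes_below_mono)
qed

lemma vanishes_below_const_mult:
  assumes "vanishes_below r f"
  shows "vanishes_below r (gmonom c 0 * (of_nat i * of_nat j) * f)"
  using vanishes_below_mult[OF vanishes_below_mult[OF vanishes_below_gmonom[of 0 c]
      vanishes_below_mult[OF vanishes_below_of_nat[of i] vanishes_below_of_nat[of j]]] assms] by simp

lemma taylor_altdef:
  "taylor c n k l s u = (\<Sum>i\<le>n. \<Sum>j\<le>n.
     gmonom (c i j) 0 * (of_nat (i choose k) * of_nat (j choose l)) * (s ^ (i - k) * u ^ (j - l)))"
  by (simp add: taylor_def mult_ac)

lemma vanishes_below_taylor:
  assumes "vanishes_below m s" "vanishes_below m u" "m \<le> 0"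
  shows "vanishes_below (2 * of_nat n * m) (taylor c n k l s u)"
  unfolding taylor_altdef
  by (intro vanishes_below_sum vanishes_below_const_mult vanishes_below_taylor_term assms) auto

text \<open>Telescoping: \<open>f^(i+1) - g^(i+1) = f (f^i - g^i) + (f - g) g^i\<close>.\<close>

lemma vanishes_below_power_diff:
  assumes "vanishes_below m f" "vanishes_below m g" "vanishes_below \<eta> (f - g)" "m \<le> 0"
  shows "vanishes_below (\<eta> + of_nat i * m) (f ^ i - g ^ i)"
proof (induction i)
  case (Suc i)
  have "vanishes_below (m + (\<eta> + of_nat i * m)) (f * (f ^ i - g ^ i))"
    by (intro vanishes_below_mult assms Suc)
  moreover have "vanishes_below (\<eta> + of_nat i * m) ((f - g) * g ^ i)"
    by (intro vanishes_below_mult vanishes_below_power assms)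
  ultimately have "vanishes_below (\<eta> + of_nat (Suc i) * m) (f * (f ^ i - g ^ i) + (f - g) * g ^ i)"
    using assms(4) by (intro vanishes_below_add) (auto elim!: vanishes_below_mono simp: algebra_simps)
  then show ?case by (simp add: algebra_simps)
qed simp

text \<open>Continuity of Taylor coefficients: agreement of the arguments up to order
  \<open>\<eta>\<close> is lost only by an amount independent of \<open>\<eta>\<close>, so a long
  enough truncation may replace the solution.\<close>

lemma vanishes_below_taylor_diff:
  assumes "vanishes_below m s" "vanishes_below m u" "vanishes_below m s'" "vanishes_below m u'"
    and "vanishes_below \<eta> (s - s')" "vanishes_below \<eta> (u - u')" "m \<le> 0"
  shows "vanishes_below (\<eta> + 2 * of_nat n * m) (taylor c n k l s u - taylor c n k l s' u')"
proof -
  have *: "vanishes_below (\<eta> + 2 * of_nat n * m) (s ^ i * u ^ j - s' ^ i * u' ^ j)"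
    if "i \<le> n" "j \<le> n" for i j
  proof -
    have le: "of_nat n * m \<le> of_nat i * m" "of_nat n * m \<le> of_nat j * m"
      using assms that by (intro mult_right_mono_neg; simp)+
    have "vanishes_below (of_nat i * m + (\<eta> + of_nat j * m)) (s ^ i * (u ^ j - u' ^ j))"
      using assms by (intro vanishes_below_mult vanishes_below_power vanishes_below_power_diff)
    moreover have "vanishes_below ((\<eta> + of_nat i * m) + of_nat j * m) ((s ^ i - s' ^ i) * u' ^ j)"
      using assms by (intro vanishes_below_mult vanishes_below_power vanishes_below_power_diff)
    ultimately have "vanishes_below (\<eta> + 2 * of_nat n * m) (s ^ i * (u ^ j - u' ^ j) + (s ^ i - s' ^ i) * u' ^ j)"
      by (intro vanishes_below_add) (use le in \<open>auto elim!: vanishes_below_mono simp: algebra_simps\<close>)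
    then show ?thesis by (simp add: algebra_simps)
  qed
  have "taylor c n k l s u - taylor c n k l s' u' = (\<Sum>i\<le>n. \<Sum>j\<le>n.
     gmonom (c i j) 0 * (of_nat (i choose k) * of_nat (j choose l)) *
       (s ^ (i - k) * u ^ (j - l) - s' ^ (i - k) * u' ^ (j - l)))"
    unfolding taylor_altdef sum_subtractf[symmetric] right_diff_distrib ..
  also have "vanishes_below (\<eta> + 2 * of_nat n * m) \<dots>"
    by (intro vanishes_below_sum vanishes_below_const_mult *) auto
  finally show ?thesis .
qed

section \<open>Truncations and the linearized equation\<close>

definition head :: "real \<Rightarrow> gps \<Rightarrow> gps" where
  "head \<nu> f = Abs_gps (\<lambda>a. if a < \<nu> then gcoeff f a else 0)"

lemma gcoeff_head: "gcoeff (head \<nu> f) a = (if a < \<nu> then gcoeff f a else 0)"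
  unfolding head_def by (subst gcoeff_Abs_support[of f f]) simp_all

lemma fin_supp_head: "fin_supp (head \<nu> f)"
  unfolding fin_supp_def by (rule finite_subset[OF _ finite_gcoeff[of f \<nu>]]) (auto simp: gcoeff_head)

lemma vanishes_below_head: "vanishes_below m f \<Longrightarrow> vanishes_below m (head \<nu> f)"
  by (simp add: vanishes_below_def gcoeff_head)

lemma vanishes_below_tail: "vanishes_below \<nu> (f - head \<nu> f)"
  by (simp add: vanishes_below_def gcoeff_head)

lemma gderiv_diff: "gderiv (f - g) = gderiv f - gderiv g"
  by (rule gps_eqI) (simp add: gcoeff_gderiv algebra_simps)

lemma gmonom_mult_cancel: "gmonom c m * (gmonom d k * f) = gmonom (c * d) (m + k) * f"
  by (simp add: mult.assoc[symmetric] gmonom_mult_gmonom)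

text \<open>Differentiating the equation gives \<open>A f + B f' = 0\<close> with
  \<open>f = s'\<close>. To leading order \<open>f'\<close> is \<open>\<sigma> f / x\<close> and
  \<open>B\<close> is \<open>b x^\<beta>\<close>, hence \<open>A\<close> must begin like
  \<open>- b \<sigma> x^(\<beta> - 1)\<close>; the next exponents of \<open>A\<close> and
  \<open>B\<close> are a positive distance away.\<close>

lemma linearized_coefficients:
  assumes sol: "taylor c n 0 0 s (gderiv s) = 0"
    and B: "gcoeff (taylor c n 0 1 s (gderiv s)) \<beta> = b" "b \<noteq> 0"
      "vanishes_below \<beta> (taylor c n 0 1 s (gderiv s))"
    and \<sigma>: "gcoeff (gderiv s) \<sigma> \<noteq> 0" "vanishes_below \<sigma> (gderiv s)"
  obtains \<epsilon> where "\<epsilon> > 0" "\<epsilon> \<le> 1"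
    "vanishes_below (\<beta> - 1 + \<epsilon>) (taylor c n 1 0 s (gderiv s) + gmonom (b * of_real \<sigma>) (\<beta> - 1))"
    "vanishes_below (\<beta> + \<epsilon>) (taylor c n 0 1 s (gderiv s) - gmonom b \<beta>)"
proof -
  define A where "A = taylor c n 1 0 s (gderiv s)"
  define B where "B = taylor c n 0 1 s (gderiv s)"
  define f where "f = gderiv s"
  have AB: "A * f + B * gderiv f = 0"
    using gderiv_taylor[of c n s "gderiv s"] unfolding sol A_def B_def f_def
    by (metis gderiv_gmonom_0 gmonom_0)
  have "A * f = - (B * gderiv f)" using AB by (simp add: eq_neg_iff_add_eq_0)
  \<comment> \<open>Both terms on the right have the same leading term, so their difference gains
    order, and dividing by \<open>f\<close> transfers the gain to the bracket.\<close>
  then have eq: "f * (A + gmonom (b * of_real \<sigma>) (\<beta> - 1)) = gmonom (b * of_real \<sigma>) (\<beta> - 1) * f - B * gderiv f"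
    by (simp add: algebra_simps)
  have f': "vanishes_below (\<sigma> - 1) (gderiv f)" "gcoeff (gderiv f) (\<sigma> - 1) = of_real \<sigma> * gcoeff f \<sigma>"
    using \<sigma> by (simp_all add: f_def vanishes_below_gderiv gcoeff_gderiv)
  have 1: "vanishes_below (\<beta> - 1 + \<sigma>) (gmonom (b * of_real \<sigma>) (\<beta> - 1) * f)"
    using \<sigma> by (intro vanishes_below_mult vanishes_below_gmonom) (simp add: f_def)
  have 2: "vanishes_below (\<beta> + (\<sigma> - 1)) (B * gderiv f)"
    using assms f' by (intro vanishes_below_mult) (simp_all add: B_def)
  have "gcoeff (B * gderiv f) (\<beta> + (\<sigma> - 1)) = b * (of_real \<sigma> * gcoeff f \<sigma>)"
    using assms f' by (subst gcoeff_mult_leading) (simp_all add: B_def)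
  moreover have "\<beta> + (\<sigma> - 1) = \<beta> - 1 + \<sigma>" by simp
  ultimately have 3: "gcoeff (f * (A + gmonom (b * of_real \<sigma>) (\<beta> - 1))) (\<beta> - 1 + \<sigma>) = 0"
    unfolding eq by (simp add: gcoeff_gmonom_mult)
  have "vanishes_below (\<beta> - 1 + \<sigma>) (f * (A + gmonom (b * of_real \<sigma>) (\<beta> - 1)))"
    unfolding eq using 1 2 by (intro vanishes_below_diff) (simp_all add: algebra_simps)
  from ex_vanishes_below_next[OF this 3] obtain \<epsilon>1 where \<epsilon>1: "\<epsilon>1 > 0"
    "vanishes_below (\<beta> - 1 + \<sigma> + \<epsilon>1) (f * (A + gmonom (b * of_real \<sigma>) (\<beta> - 1)))"
    by blast
  have assoc: "\<sigma> + (\<beta> - 1 + \<epsilon>1) = \<beta> - 1 + \<sigma> + \<epsilon>1" by simp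
  have "vanishes_below (\<sigma> + (\<beta> - 1 + \<epsilon>1)) (f * (A + gmonom (b * of_real \<sigma>) (\<beta> - 1)))"
    unfolding assoc by (rule \<epsilon>1(2))
  then have A1: "vanishes_below (\<beta> - 1 + \<epsilon>1) (A + gmonom (b * of_real \<sigma>) (\<beta> - 1))"
    by (rule vanishes_below_cancel[rotated 2]) (use \<sigma> in \<open>simp_all add: f_def\<close>)
  have "vanishes_below \<beta> (B - gmonom b \<beta>)"
    using assms by (intro vanishes_below_diff vanishes_below_gmonom) (simp add: B_def)
  moreover have "gcoeff (B - gmonom b \<beta>) \<beta> = 0" using assms by (simp add: B_def gcoeff_gmonom)
  ultimately obtain \<epsilon>2 where \<epsilon>2: "\<epsilon>2 > 0" "vanishes_below (\<beta> + \<epsilon>2) (B - gmonom b \<beta>)"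
    using ex_vanishes_below_next by blast
  show ?thesis
  \<comment> \<open>The cap at 1 is used later, where terms of degree at least 2 are only shown to
    have order at least 1.\<close>
  proof (rule that[of "min 1 (min \<epsilon>1 \<epsilon>2)"])
    show "vanishes_below (\<beta> - 1 + min 1 (min \<epsilon>1 \<epsilon>2)) (taylor c n 1 0 s (gderiv s) + gmonom (b * of_real \<sigma>) (\<beta> - 1))"
      using A1 unfolding A_def by (rule vanishes_below_mono) simp
    show "vanishes_below (\<beta> + min 1 (min \<epsilon>1 \<epsilon>2)) (taylor c n 0 1 s (gderiv s) - gmonom b \<beta>)"
      using \<epsilon>2(2) unfolding B_def by (rule vanishes_below_mono) simp
  qed (use \<epsilon>1 \<epsilon>2 in auto)
qed

text \<open>The linear part of the equation for the tail of a solution is \<open>x d/dx - \<sigma>\<close> up to terms of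
  higher order, because \<open>s'\<close>, of order \<open>\<sigma>\<close>, solves the linearized equation.  With
  \<open>s = head \<nu> s + x^\<nu> V\<close> and \<open>\<nu>\<close> large, everything else is absorbed into coefficients \<open>e k l\<close>
  of positive order.\<close>

lemma tail_equation:
  assumes n: "n \<ge> 1"
    and sol: "taylor c n 0 0 s (gderiv s) = 0"
    and nondeg: "taylor c n 0 1 s (gderiv s) \<noteq> 0"
    and \<sigma>: "gcoeff (gderiv s) \<sigma> \<noteq> 0" "vanishes_below \<sigma> (gderiv s)"
  obtains \<nu> \<epsilon> :: real and e :: "nat \<Rightarrow> nat \<Rightarrow> gps" and V :: gps
  where "\<epsilon> > 0" "\<nu> \<in> \<rat>" "\<nu> \<ge> 1" "\<nu> \<ge> 1 + \<sigma>"
    "s = head \<nu> s + gmonom 1 \<nu> * V" "vanishes_below 0 V"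
    "\<And>a. of_real (a + \<nu> - \<sigma>) * gcoeff V a =
       gcoeff (\<Sum>k\<le>n. \<Sum>l\<le>n. e k l * (V ^ k * gdiff (\<lambda>a. a + \<nu>) V ^ l)) a"
    "\<And>k l. fin_supp (e k l)"
    "\<And>k l. (k, l) \<noteq> (0, 0) \<Longrightarrow> k \<le> n \<Longrightarrow> l \<le> n \<Longrightarrow> vanishes_below \<epsilon> (e k l)"
    "vanishes_below 0 (e 0 0)"
    "\<And>k l. supp_in \<rat> s \<Longrightarrow> supp_in \<rat> (e k l)"
proof -
  define u where "u = gderiv s"
  obtain \<beta> where \<beta>: "gcoeff (taylor c n 0 1 s u) \<beta> \<noteq> 0" "vanishes_below \<beta> (taylor c n 0 1 s u)"
    using gps_nonzero_leading[OF nondeg] unfolding u_def by blast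
  define b where "b = gcoeff (taylor c n 0 1 s u) \<beta>"
  obtain \<epsilon> where \<epsilon>: "\<epsilon> > 0" "\<epsilon> \<le> 1"
    and A1: "vanishes_below (\<beta> - 1 + \<epsilon>) (taylor c n 1 0 s u + gmonom (b * of_real \<sigma>) (\<beta> - 1))"
    and B1: "vanishes_below (\<beta> + \<epsilon>) (taylor c n 0 1 s u - gmonom b \<beta>)"
    using linearized_coefficients[OF sol, of \<beta> b \<sigma>] \<beta> \<sigma> unfolding b_def u_def by blast
  obtain m where m: "vanishes_below m s" "vanishes_below m u" "m \<le> 0"
  proof -
    obtain m1 m2 where "vanishes_below m1 s" "vanishes_below m2 u" using ex_vanishes_below by metis
    then show ?thesis
      by (intro that[of "min 0 (min m1 m2)"]) (auto elim: vanishes_below_mono)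
  qed
  \<comment> \<open>The uniform loss of order in the crude Taylor estimates.\<close>
  define M where "M = - 2 * of_nat n * m"
  have M: "M \<ge> 0" using m by (simp add: M_def mult_nonneg_nonpos)
  \<comment> \<open>A natural number, hence rational. \<open>1 + \<sigma>\<close> keeps
    \<open>a + \<nu> - \<sigma>\<close> at least 1; \<open>2 + \<beta> + M\<close> makes the
    truncation errors and the terms of degree at least 2 small against \<open>B\<close>, of order
    \<open>\<beta>\<close>.\<close>
  obtain \<nu> :: real where \<nu>: "\<nu> \<in> \<rat>" "\<nu> \<ge> 1" "\<nu> \<ge> 1 + \<sigma>" "\<nu> \<ge> 2 + \<beta> + M"
  proof -
    obtain N where "max 1 (max (1 + \<sigma>) (2 + \<beta> + M)) \<le> real N" using real_arch_simple by blast
    then show ?thesis by (intro that[of "real N"]) auto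
  qed
  define t where "t = head \<nu> s"
  define V where "V = gmonom 1 (- \<nu>) * (s - t)"
  \<comment> \<open>Chosen so that \<open>x^(\<nu> - 1) W\<close> is the derivative of
    \<open>x^\<nu> V\<close>.\<close>
  define W where "W = gdiff (\<lambda>a. a + \<nu>) V"
  define T where "T k l = taylor c n k l t (gderiv t)" for k l
  have b: "b \<noteq> 0" using \<beta> by (simp add: b_def)
  have sV: "s - t = gmonom 1 \<nu> * V"
    by (simp add: V_def gmonom_mult_cancel)
  have uW: "u - gderiv t = gmonom 1 (\<nu> - 1) * W"
  proof (rule gps_eqI)
    fix a
    have "u - gderiv t = gderiv (gmonom 1 \<nu> * V)" by (simp add: u_def gderiv_diff flip: sV)
    moreover have "a - (\<nu> - 1) = a + 1 - \<nu>" by simp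
    ultimately show "gcoeff (u - gderiv t) a = gcoeff (gmonom 1 (\<nu> - 1) * W) a"
      by (simp only: gcoeff_gderiv gcoeff_gmonom_mult W_def gcoeff_gdiff) simp
  qed
  have V0: "vanishes_below 0 V"
    using vanishes_below_mult[OF vanishes_below_gmonom vanishes_below_tail[of \<nu> s], of "- \<nu>" 1]
    by (simp add: V_def t_def)
  have W0: "vanishes_below 0 W" unfolding W_def by (rule vanishes_below_gdiff[OF V0])
  have tm: "vanishes_below m t" using m by (simp add: t_def vanishes_below_head)
  have "gderiv t = head (\<nu> - 1) u"
    by (rule gps_eqI) (auto simp: gcoeff_gderiv t_def u_def gcoeff_head)
  then have um: "vanishes_below m (gderiv t)" and ut: "vanishes_below (\<nu> - 1) (u - gderiv t)"
    using m by (simp_all add: vanishes_below_head vanishes_below_tail)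
  have st: "vanishes_below (\<nu> - 1) (s - t)"
    using vanishes_below_tail[of \<nu> s] unfolding t_def by (rule vanishes_below_mono) simp
  have TM: "vanishes_below (- M) (T k l)" for k l
    using vanishes_below_taylor[OF tm um m(3), of n c k l] by (simp add: T_def M_def)
  have Tdiff: "vanishes_below (\<nu> - 1 - M) (T k l - taylor c n k l s u)" for k l
    using vanishes_below_uminus[OF vanishes_below_taylor_diff[OF m(1,2) tm um st ut m(3), of n c k l]]
    by (simp add: T_def M_def)
  \<comment> \<open>The Taylor expansion about the truncation, divided by
    \<open>- b x^(\<beta> + \<nu> - 1)\<close>; each factor \<open>V\<close> contributes
    \<open>x^\<nu>\<close> and each factor \<open>W\<close> contributes
    \<open>x^(\<nu> - 1)\<close>.\<close>
  define h where "h k l = gmonom (- 1 / b) (1 - \<beta> - \<nu> + (\<nu> * (real k + real l) - real l)) * T k l" for k l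
  \<comment> \<open>By the linearized equation the linear part of the \<open>h\<close>-sum is close
    to \<open>\<sigma> V - W\<close>. Removing exactly that part leaves small coefficients and puts
    \<open>W - \<sigma> V\<close> on the other side of the equation.\<close>
  define e where "e k l = h k l + (if (k, l) = (1, 0) then gmonom (- of_real \<sigma>) 0
      else if (k, l) = (0, 1) then 1 else 0)" for k l
  have hsum: "(\<Sum>k\<le>n. \<Sum>l\<le>n. h k l * (V ^ k * W ^ l)) = 0"
  proof -
    have "0 = taylor c n 0 0 (t + gmonom 1 \<nu> * V) (gderiv t + gmonom 1 (\<nu> - 1) * W)"
      using sol by (simp add: u_def flip: sV uW)
    also have "\<dots> = (\<Sum>k\<le>n. \<Sum>l\<le>n. T k l * ((gmonom 1 \<nu> * V) ^ k * (gmonom 1 (\<nu> - 1) * W) ^ l))"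
      unfolding T_def by (rule taylor_expansion)
    finally have "0 = gmonom (- 1 / b) (1 - \<beta> - \<nu>) * \<dots>" by simp
    also have "\<dots> = (\<Sum>k\<le>n. \<Sum>l\<le>n. gmonom (- 1 / b) (1 - \<beta> - \<nu>) *
        (T k l * ((gmonom 1 \<nu> * V) ^ k * (gmonom 1 (\<nu> - 1) * W) ^ l)))"
      by (simp only: sum_distrib_left)
    also have "\<dots> = (\<Sum>k\<le>n. \<Sum>l\<le>n. h k l * (V ^ k * W ^ l))"
    proof (intro sum.cong refl)
      fix k l
      have "gmonom (- 1 / b) (1 - \<beta> - \<nu>) * (T k l * ((gmonom 1 \<nu> * V) ^ k * (gmonom 1 (\<nu> - 1) * W) ^ l))
        = (gmonom (- 1 / b) (1 - \<beta> - \<nu>) * (gmonom 1 \<nu> ^ k * gmonom 1 (\<nu> - 1) ^ l)) * T k l * (V ^ k * W ^ l)"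
        by (simp add: power_mult_distrib mult_ac)
      also have "gmonom (- 1 / b) (1 - \<beta> - \<nu>) * (gmonom 1 \<nu> ^ k * gmonom 1 (\<nu> - 1) ^ l)
        = gmonom (- 1 / b) (1 - \<beta> - \<nu> + (\<nu> * (real k + real l) - real l))"
        by (simp add: gmonom_power gmonom_mult_gmonom algebra_simps)
      finally show "gmonom (- 1 / b) (1 - \<beta> - \<nu>) * (T k l * ((gmonom 1 \<nu> * V) ^ k * (gmonom 1 (\<nu> - 1) * W) ^ l))
        = h k l * (V ^ k * W ^ l)" by (simp add: h_def)
    qed
    finally show ?thesis by simp
  qed
  have esum: "(\<Sum>k\<le>n. \<Sum>l\<le>n. e k l * (V ^ k * W ^ l)) = W - gmonom (of_real \<sigma>) 0 * V"
  proof -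
    have neg: "gmonom (- of_real \<sigma>) 0 = - gmonom (of_real \<sigma>) 0"
      by (rule gps_eqI) (simp add: gcoeff_gmonom)
    have "(\<Sum>k\<le>n. \<Sum>l\<le>n. e k l * (V ^ k * W ^ l)) = (\<Sum>k\<le>n. \<Sum>l\<le>n. h k l * (V ^ k * W ^ l)) +
       (\<Sum>k\<le>n. \<Sum>l\<le>n. (if l = 0 then if k = 1 then gmonom (- of_real \<sigma>) 0 * V else 0 else 0)) +
       (\<Sum>k\<le>n. \<Sum>l\<le>n. (if l = 1 then if k = 0 then W else 0 else 0))"
      unfolding sum.distrib[symmetric] by (intro sum.cong refl) (simp add: e_def algebra_simps)
    also have "\<dots> = gmonom (- of_real \<sigma>) 0 * V + W"
      using n by (simp add: hsum)
    finally show ?thesis by (simp add: neg)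
  qed
  \<comment> \<open>Two errors are separated: replacing \<open>s\<close> by its truncation, small by
    the choice of \<open>\<nu>\<close>, and replacing the partial derivative at \<open>s\<close> by
    its leading term, of relative order \<open>\<epsilon>\<close>.\<close>
  have e10: "e 1 0 = gmonom (- 1 / b) (1 - \<beta>) * (T 1 0 - taylor c n 1 0 s u +
      (taylor c n 1 0 s u + gmonom (b * of_real \<sigma>) (\<beta> - 1)))"
    using b by (simp add: e_def h_def algebra_simps gmonom_mult_gmonom)
  have e01: "e 0 1 = gmonom (- 1 / b) (- \<beta>) * (T 0 1 - taylor c n 0 1 s u +
      (taylor c n 0 1 s u - gmonom b \<beta>))"
    using b by (simp add: e_def h_def algebra_simps gmonom_mult_gmonom)
      (metis add.commute gmonom_1_0 gmonom_add gmonom_0 right_minus)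
  have e_pos: "vanishes_below \<epsilon> (e k l)" if kl: "(k, l) \<noteq> (0, 0)" for k l
  proof -
    consider "k = 1" "l = 0" | "k = 0" "l = 1" | "k + l \<ge> 2" using kl by fastforce
    then show ?thesis
    proof cases
      case 1
      have "vanishes_below (1 - \<beta> + (\<beta> - 1 + \<epsilon>)) (e 1 0)"
        unfolding e10 using \<nu> \<epsilon>
        by (intro vanishes_below_mult vanishes_below_gmonom vanishes_below_add A1
            vanishes_below_mono[OF Tdiff]) simp_all
      then show ?thesis using 1 by simp
    next
      case 2
      have "vanishes_below (- \<beta> + (\<beta> + \<epsilon>)) (e 0 1)"
        unfolding e01 using \<nu> \<epsilon>
        by (intro vanishes_below_mult vanishes_below_gmonom vanishes_below_add B1
            vanishes_below_mono[OF Tdiff]) simp_all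
      then show ?thesis using 2 by simp
    next
      case 3
      then have "e k l = h k l" by (auto simp: e_def)
      moreover have "vanishes_below (1 - \<beta> - \<nu> + (\<nu> * (real k + real l) - real l) + (- M)) (h k l)"
        unfolding h_def by (intro vanishes_below_mult vanishes_below_gmonom TM)
      \<comment> \<open>Every factor beyond the first gains at least
        \<open>\<nu> - 1 \<ge> 1 + \<beta> + M\<close>, which pays for the division by
        \<open>x^\<beta>\<close> and for the loss \<open>M\<close>.\<close>
      moreover have "(\<nu> - 1) * 1 \<le> (\<nu> - 1) * (real k + real l - 1)"
        using 3 \<nu> by (intro mult_left_mono) linarith+
      then have "\<epsilon> \<le> 1 - \<beta> - \<nu> + (\<nu> * (real k + real l) - real l) + (- M)"
        using \<nu>(4) \<epsilon>(2) by (simp add: algebra_simps)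
      ultimately show ?thesis using vanishes_below_mono by metis
    qed
  qed
  \<comment> \<open>The constant term is the truncation inserted into the equation. Its order comes
    from the equation itself: it equals a combination of terms already known to have order at least
    0.\<close>
  have e00: "vanishes_below 0 (e 0 0)"
  proof -
    have pos: "vanishes_below 0 (e k l * (V ^ k * W ^ l))" if "(k, l) \<noteq> (0, 0)" for k l
    proof -
      have "vanishes_below (\<epsilon> + (of_nat k * 0 + of_nat l * 0)) (e k l * (V ^ k * W ^ l))"
        by (intro vanishes_below_mult vanishes_below_power e_pos that V0 W0)
      then show ?thesis using \<epsilon> by (auto elim: vanishes_below_mono)
    qed
    have "(\<Sum>k\<le>n. \<Sum>l\<le>n. e k l * (V ^ k * W ^ l)) =
      (\<Sum>k\<le>n. \<Sum>l\<le>n. if (k, l) = (0, 0) then 0 else e k l * (V ^ k * W ^ l)) +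
      (\<Sum>k\<le>n. \<Sum>l\<le>n. if l = 0 then if k = 0 then e 0 0 else 0 else 0)"
      unfolding sum.distrib[symmetric] by (intro sum.cong refl) simp
    also have "(\<Sum>k\<le>n. \<Sum>l\<le>n. if l = 0 then if k = 0 then e 0 0 else 0 else 0) = e 0 0" by simp
    finally have "e 0 0 = W - gmonom (of_real \<sigma>) 0 * V -
      (\<Sum>k\<le>n. \<Sum>l\<le>n. if (k, l) = (0, 0) then 0 else e k l * (V ^ k * W ^ l))"
      by (simp add: esum)
    also have "vanishes_below 0 \<dots>"
      using vanishes_below_mult[OF vanishes_below_gmonom V0, of 0 "of_real \<sigma>"]
      by (intro vanishes_below_diff vanishes_below_sum W0) (simp_all add: pos)
    finally show ?thesis .
  qed
  have e_fin: "fin_supp (e k l)" for k l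
  proof -
    have "fin_supp (T k l)" unfolding T_def t_def
      by (intro fin_supp_taylor fin_supp_gderiv fin_supp_head)
    then have "fin_supp (h k l)" unfolding h_def by (intro fin_supp_mult fin_supp_gmonom)
    then show ?thesis using fin_supp_gmonom[of 1 0] unfolding e_def
      by (intro fin_supp_add) (simp_all add: fin_supp_gmonom fin_supp_0)
  qed
  have e_rat: "supp_in \<rat> (e k l)" if s: "supp_in \<rat> s" for k l
  proof -
    have Q: "add_closed \<rat>" "-1 \<in> \<rat>" by (simp_all add: add_closed_def)
    have "supp_in \<rat> t" using s by (simp add: supp_in_def t_def gcoeff_head)
    then have T: "supp_in \<rat> (T k l)" unfolding T_def using Q by (intro supp_in_taylor supp_in_gderiv)
    have "supp_in \<rat> (taylor c n 0 1 s u)" unfolding u_def using Q s by (intro supp_in_taylor supp_in_gderiv)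
    then have "\<beta> \<in> \<rat>" using \<beta> by (simp add: supp_in_def)
    then have "supp_in \<rat> (h k l)" unfolding h_def using Q T \<nu>(1) by (intro supp_in_mult supp_in_gmonom) auto
    then show ?thesis using Q supp_in_1[of \<rat>] unfolding e_def
      by (intro supp_in_add) (simp_all add: supp_in_gmonom, simp add: supp_in_def)
  qed
  have eqn: "of_real (a + \<nu> - \<sigma>) * gcoeff V a = gcoeff (\<Sum>k\<le>n. \<Sum>l\<le>n. e k l * (V ^ k * W ^ l)) a" for a
  proof -
    have "gcoeff W a = of_real (a + \<nu>) * gcoeff V a" by (simp add: W_def gcoeff_gdiff)
    then show ?thesis unfolding esum gcoeff_diff gcoeff_gmonom_mult by (simp add: algebra_simps)
  qed
  have s_eq: "s = head \<nu> s + gmonom 1 \<nu> * V"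
    unfolding sV[symmetric] t_def by simp
  show ?thesis
    by (rule that[OF \<epsilon>(1) \<nu>(1-3) s_eq V0 eqn[unfolded W_def] e_fin e_pos e00 e_rat])
qed

subsection \<open>Common denominators\<close>

definition supp_below :: "real \<Rightarrow> real set \<Rightarrow> gps \<Rightarrow> bool" where
  "supp_below R \<Gamma> f \<longleftrightarrow> (\<forall>a<R. gcoeff f a \<noteq> 0 \<longrightarrow> a \<in> \<Gamma>)"

text \<open>A factor of order at least \<open>p\<close> shifts exponents upwards, so the other
  factor matters only below \<open>R - p\<close>. This gap drives the induction for the
  tail.\<close>

lemma supp_below_mult:
  assumes "add_closed \<Gamma>" "vanishes_below p f" "vanishes_below q g"
    and "supp_below (R - q) \<Gamma> f" "supp_below (R - p) \<Gamma> g"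
  shows "supp_below R \<Gamma> (f * g)"
  unfolding supp_below_def
proof (intro allI impI)
  fix a assume a: "a < R" "gcoeff (f * g) a \<noteq> 0"
  then obtain u where u: "gcoeff f u \<noteq> 0" "gcoeff g (a - u) \<noteq> 0" by (metis gcoeff_mult_nonzeroD)
  then have "p \<le> u" "q \<le> a - u" using assms(2,3) vanishes_belowD by auto
  then have "u \<in> \<Gamma>" "a - u \<in> \<Gamma>" using assms(4,5) u a by (auto simp: supp_below_def)
  then have "u + (a - u) \<in> \<Gamma>" using assms(1) unfolding add_closed_def by blast
  then show "a \<in> \<Gamma>" by simp
qed

lemma supp_below_power:
  assumes "add_closed \<Gamma>" "vanishes_below 0 f" "supp_below R \<Gamma> f"
  shows "supp_below R \<Gamma> (f ^ k)"
proof (induction k)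
  case 0
  then show ?case using assms(1) by (simp add: supp_below_def gcoeff_1 add_closed_def)
next
  case (Suc k)
  have "vanishes_below 0 (f ^ k)" using vanishes_below_power[OF assms(2), of k] by simp
  then show ?case using supp_below_mult[of \<Gamma> 0 f 0 "f ^ k" R] assms Suc by simp
qed

text \<open>In the equation for the coefficient at \<open>a\<close>, the coefficients of
  \<open>V\<close> enter the right side only at exponents up to \<open>a - \<epsilon>\<close>, and
  the factor \<open>a + \<nu> - \<sigma>\<close> is nonzero. Induction in steps of
  \<open>\<epsilon>\<close> keeps the exponents in the monoid containing those of all
  \<open>e k l\<close>.\<close>

lemma supp_in_tail:
  assumes "\<epsilon> > 0" "\<nu> \<ge> 1 + \<sigma>" "vanishes_below 0 V"
    and eqn: "\<And>a. of_real (a + \<nu> - \<sigma>) * gcoeff V a =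
       gcoeff (\<Sum>k\<le>n. \<Sum>l\<le>n. e k l * (V ^ k * gdiff (\<lambda>a. a + \<nu>) V ^ l)) a"
    and e: "\<And>k l. (k, l) \<noteq> (0, 0) \<Longrightarrow> k \<le> n \<Longrightarrow> l \<le> n \<Longrightarrow> vanishes_below \<epsilon> (e k l)"
    and \<Gamma>: "add_closed \<Gamma>" "\<And>k l. k \<le> n \<Longrightarrow> l \<le> n \<Longrightarrow> supp_in \<Gamma> (e k l)"
  shows "supp_in \<Gamma> V"
proof -
  define W where "W = gdiff (\<lambda>a. a + \<nu>) V"
  have W0: "vanishes_below 0 W" unfolding W_def by (rule vanishes_below_gdiff) fact
  have step: "supp_below (of_nat m * \<epsilon>) \<Gamma> V" for m
  proof (induction m)
    case 0
    then show ?case using assms(3) by (auto simp: supp_below_def vanishes_below_def)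
  next
    case (Suc m)
    then have W: "supp_below (of_nat m * \<epsilon>) \<Gamma> W" by (auto simp: supp_below_def W_def gcoeff_gdiff)
    show ?case
      unfolding supp_below_def
    proof (intro allI impI)
      fix a assume a: "a < of_nat (Suc m) * \<epsilon>" "gcoeff V a \<noteq> 0"
      then have "a \<ge> 0" using assms(3) vanishes_belowD by blast
      with assms(2) have "complex_of_real (a + \<nu> - \<sigma>) \<noteq> 0" unfolding of_real_eq_0_iff by linarith
      with a(2) have "gcoeff (\<Sum>k\<le>n. \<Sum>l\<le>n. e k l * (V ^ k * W ^ l)) a \<noteq> 0"
        unfolding W_def by (simp only: eqn[symmetric] mult_eq_0_iff) simp
      then obtain k l where kl: "k \<le> n" "l \<le> n" "gcoeff (e k l * (V ^ k * W ^ l)) a \<noteq> 0"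
        unfolding gcoeff_sum by (metis (no_types, lifting) atMost_iff sum.not_neutral_contains_not_neutral)
      show "a \<in> \<Gamma>"
      proof (cases "(k, l) = (0, 0)")
        case True
        then show ?thesis using kl \<Gamma>(2)[of 0 0] by (simp add: supp_in_def)
      next
        case False
        have "supp_below (of_nat (Suc m) * \<epsilon>) \<Gamma> (e k l * (V ^ k * W ^ l))"
        proof (rule supp_below_mult[OF \<Gamma>(1) e[OF False kl(1,2)]])
          show "vanishes_below 0 (V ^ k * W ^ l)"
            using vanishes_below_mult[OF vanishes_below_power[OF assms(3), of k] vanishes_below_power[OF W0, of l]] by simp
          show "supp_below (of_nat (Suc m) * \<epsilon> - 0) \<Gamma> (e k l)"
            using \<Gamma>(2)[OF kl(1,2)] by (simp add: supp_below_def supp_in_def)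
          have "supp_below (of_nat m * \<epsilon>) \<Gamma> (V ^ k * W ^ l)"
            using vanishes_below_power[OF assms(3), of k] vanishes_below_power[OF W0, of l]
            by (intro supp_below_mult[of _ 0 _ 0]) (simp_all add: supp_below_power \<Gamma>(1) Suc W assms(3) W0)
          then show "supp_below (of_nat (Suc m) * \<epsilon> - \<epsilon>) \<Gamma> (V ^ k * W ^ l)"
            by (simp add: algebra_simps)
        qed
        then show ?thesis using a(1) kl(3) by (auto simp: supp_below_def)
      qed
    qed
  qed
  show ?thesis
    unfolding supp_in_def
  proof (intro allI impI)
    fix a assume a: "gcoeff V a \<noteq> 0"
    obtain m where "a < of_nat m * \<epsilon>" using reals_Archimedean3[OF assms(1)] by blast
    then show "a \<in> \<Gamma>" using step[of m] a by (simp add: supp_below_def)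
  qed
qed

text \<open>\<open>a\<close> and 1 are linearly independent over \<rat>, so prescribed values on
  them extend to all reals by completing to a Hamel basis.\<close>

lemma ex_rational_linear_functional:
  assumes "a \<notin> \<rat>"
  shows "\<exists>l :: real \<Rightarrow> real. (\<forall>x y. l (x + y) = l x + l y) \<and> l 1 = 0 \<and> l a = 1"
proof -
  interpret Q: vector_space "\<lambda>(q::rat) (x::real). of_rat q * x"
    by standard (simp_all add: algebra_simps of_rat_add of_rat_mult)
  interpret QQ: vector_space_pair "\<lambda>(q::rat) (x::real). of_rat q * x" "\<lambda>(q::rat) (x::real). of_rat q * x"
    by standard
  have "a \<notin> Q.span {1}"
    using assms by (auto simp: Q.span_singleton Rats_def)
  then have "Q.independent {a, 1}"
    by (simp add: Q.independent_insert)
  then obtain g where g: "Vector_Spaces.linear (\<lambda>(q::rat) (x::real). of_rat q * x) (\<lambda>(q::rat) (x::real). of_rat q * x) g"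
    "\<forall>x\<in>{a, 1}. g x = (if x = 1 then 0 else 1)"
    using QQ.linear_independent_extend[of "{a, 1}" "\<lambda>x. if x = 1 then 0 else 1"] by blast
  have "a \<noteq> 1" using assms by auto
  show ?thesis
    using QQ.linear_add[OF g(1)] g(2) \<open>a \<noteq> 1\<close> by (intro exI[of _ g]) simp
qed

text \<open>A \<open>\<rat>\<close>-linear functional killing 1 acts on exponents as a derivation commuting with \<open>d/dx\<close>.
  It maps a solution \<open>s\<close> to a solution of the linearized equation, hence to a multiple of \<open>s'\<close>,
  but its order is larger than that of \<open>s'\<close>.\<close>

lemma supp_in_Rats:
  assumes sol: "taylor c n 0 0 s (gderiv s) = 0"
    and nondeg: "taylor c n 0 1 s (gderiv s) \<noteq> 0"
    and nonconst: "gderiv s \<noteq> 0"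
  shows "supp_in \<rat> s"
  unfolding supp_in_def
proof (intro allI impI, rule ccontr)
  fix a assume a: "gcoeff s a \<noteq> 0" "a \<notin> \<rat>"
  obtain l :: "real \<Rightarrow> real" where l': "(\<forall>x y. l (x + y) = l x + l y) \<and> l 1 = 0 \<and> l a = 1"
    using ex_rational_linear_functional[OF a(2)] by (elim exE)
  then have l: "\<And>x y. l (x + y) = l x + l y" "l 1 = 0" "l a = 1" by simp_all
  have l0: "l 0 = 0" using l(1)[of 0 0] by simp
  define A where "A = taylor c n 1 0 s (gderiv s)"
  define B where "B = taylor c n 0 1 s (gderiv s)"
  define f where "f = gderiv s"
  define g where "g = gdiff l s"
  have "A * f + B * gderiv f = 0"
    using gderiv_taylor[of c n s "gderiv s"] unfolding sol A_def B_def f_def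
    by (metis gderiv_gmonom_0 gmonom_0)
  moreover have "A * g + B * gderiv g = 0"
  proof -
    have "gdiff l 0 = 0" by (rule gps_eqI) (simp add: gcoeff_gdiff)
    then show ?thesis
      using gdiff_taylor[of l c n s "gderiv s", OF l(1)] gdiff_gderiv[of l s, OF l(1,2)]
      unfolding sol A_def B_def f_def g_def by simp
  qed
  \<comment> \<open>Eliminating \<open>A\<close> leaves \<open>B\<close> times the Wronskian of
    \<open>f\<close> and \<open>g\<close>. As \<open>B\<close> is nonzero the Wronskian vanishes,
    and comparison of leading terms makes the two orders equal.\<close>
  ultimately have "g * (A * f + B * gderiv f) - f * (A * g + B * gderiv g) = 0" by simp
  then have "B * (gderiv f * g - f * gderiv g) = 0" by (simp add: algebra_simps)
  then have eq: "gderiv f * g = f * gderiv g" using nondeg by (simp add: B_def)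
  have "gcoeff g a \<noteq> 0" using a l(3) by (simp add: g_def gcoeff_gdiff)
  then obtain \<gamma> where \<gamma>: "gcoeff g \<gamma> \<noteq> 0" "vanishes_below \<gamma> g" using leading_exponent by blast
  obtain \<sigma> where \<sigma>: "gcoeff f \<sigma> \<noteq> 0" "vanishes_below \<sigma> f"
    using gps_nonzero_leading nonconst unfolding f_def by blast
  have "gcoeff (gderiv f * g) (\<sigma> - 1 + \<gamma>) = of_real \<sigma> * gcoeff f \<sigma> * gcoeff g \<gamma>"
    using \<sigma> \<gamma> by (subst gcoeff_mult_leading) (simp_all add: vanishes_below_gderiv gcoeff_gderiv)
  moreover have "gcoeff (f * gderiv g) (\<sigma> + (\<gamma> - 1)) = gcoeff f \<sigma> * (of_real \<gamma> * gcoeff g \<gamma>)"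
    using \<sigma> \<gamma> by (subst gcoeff_mult_leading) (simp_all add: vanishes_below_gderiv gcoeff_gderiv)
  moreover have "\<sigma> - 1 + \<gamma> = \<sigma> + (\<gamma> - 1)" by simp
  ultimately have "of_real \<sigma> * gcoeff f \<sigma> * gcoeff g \<gamma> = gcoeff f \<sigma> * (of_real \<gamma> * gcoeff g \<gamma>)"
    using eq by metis
  then have "\<sigma> = \<gamma>" using \<sigma> \<gamma> by simp
  \<comment> \<open>Applying \<open>l\<close> creates no exponents and removes 0, so
    \<open>\<gamma>\<close> is a nonzero exponent of \<open>s\<close> and
    \<open>\<gamma> - 1\<close> an exponent of \<open>s'\<close>, below its order.\<close>
  have "\<gamma> \<noteq> 0" "gcoeff s \<gamma> \<noteq> 0" using \<gamma>(1) l0 by (auto simp: g_def gcoeff_gdiff)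
  then have "gcoeff f (\<gamma> - 1) \<noteq> 0" by (simp add: f_def gcoeff_gderiv)
  then have "\<sigma> \<le> \<gamma> - 1" using \<sigma>(2) vanishes_belowD by blast
  with \<open>\<sigma> = \<gamma>\<close> show False by simp
qed

lemma common_denominator:
  assumes "finite F" "F \<subseteq> \<rat>"
  obtains d :: nat where "d \<ge> 1" "\<And>x. x \<in> F \<Longrightarrow> \<exists>k::int. x = of_int k / of_nat d"
proof -
  have "\<exists>d::nat. d \<ge> 1 \<and> (\<forall>x\<in>F. \<exists>k::int. x = of_int k / of_nat d)"
    using assms
  proof (induction F)
    case empty
    then show ?case by auto
  next
    case (insert y F)
    then obtain d where d: "d \<ge> 1" "\<And>x. x \<in> F \<Longrightarrow> \<exists>k::int. x = of_int k / of_nat d" by auto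
    from insert.prems obtain p q :: int where y: "y = of_int p / of_int q" "q > 0"
      by (auto elim: Rats_cases')
    have "\<exists>k::int. x = of_int k / of_nat (d * nat q)" if x: "x \<in> insert y F" for x
    proof (cases "x = y")
      case True
      then show ?thesis using y d(1)
        by (intro exI[of _ "p * int d"]) (simp add: field_simps)
    next
      case False
      then obtain k :: int where "x = of_int k / of_nat d" using x d(2) by blast
      then show ?thesis using y d(1)
        by (intro exI[of _ "k * q"]) (simp add: field_simps)
    qed
    moreover have "d * nat q \<ge> 1" using d(1) y(2) by (simp add: Suc_leI)
    ultimately show ?case by blast
  qed
  then show ?thesis using that by blast
qed

definition fractions :: "nat \<Rightarrow> real set" where
  "fractions d = {a. \<exists>k::int. a = of_int k / of_nat d}"

lemma add_closed_fractions: "d \<ge> 1 \<Longrightarrow> add_closed (fractions d)"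
  unfolding add_closed_def fractions_def
proof (intro conjI ballI)
  show "0 \<in> {a. \<exists>k::int. a = of_int k / real d}" by (auto intro: exI[of _ 0])
  fix a b
  assume "a \<in> {a. \<exists>k::int. a = of_int k / real d}" "b \<in> {a. \<exists>k::int. a = of_int k / real d}"
  then obtain i j :: int where "a = of_int i / real d" "b = of_int j / real d" by blast
  then have "a + b = of_int (i + j) / real d" by (simp add: add_divide_distrib)
  then show "a + b \<in> {a. \<exists>k::int. a = of_int k / real d}" by blast
qed

subsection \<open>Weighted norms of truncations\<close>

text \<open>The absolute sum at radius \<open>\<rho>\<close> of the terms below exponent
  \<open>R\<close>. The cut-off makes it finite before any convergence is known; being strict, it
  leaves nothing at \<open>R = 0\<close> for a series of order at least 0, which starts the
  induction.\<close>

definition wnorm :: "real \<Rightarrow> real \<Rightarrow> gps \<Rightarrow> real" where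
  "wnorm \<rho> R f = (\<Sum>a\<in>{a. gcoeff f a \<noteq> 0 \<and> a < R}. norm (gcoeff f a) * \<rho> powr a)"

lemma finite_gcoeff_less: "finite {a. gcoeff f a \<noteq> 0 \<and> a < R}"
  by (rule finite_subset[OF _ finite_gcoeff[of f R]]) auto

lemma wnorm_altdef:
  assumes "finite F" "\<And>a. gcoeff f a \<noteq> 0 \<Longrightarrow> a < R \<Longrightarrow> a \<in> F" "\<And>a. a \<in> F \<Longrightarrow> a < R"
  shows "wnorm \<rho> R f = (\<Sum>a\<in>F. norm (gcoeff f a) * \<rho> powr a)"
  unfolding wnorm_def using assms by (intro sum.mono_neutral_left) auto

lemma wnorm_nonneg: "wnorm \<rho> R f \<ge> 0"
  unfolding wnorm_def by (intro sum_nonneg) simp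

lemma wnorm_ge_sum:
  assumes "finite F" "\<And>a. a \<in> F \<Longrightarrow> a < R"
  shows "(\<Sum>a\<in>F. norm (gcoeff f a) * \<rho> powr a) \<le> wnorm \<rho> R f"
proof -
  have "(\<Sum>a\<in>F. norm (gcoeff f a) * \<rho> powr a) \<le>
      (\<Sum>a\<in>F \<union> {a. gcoeff f a \<noteq> 0 \<and> a < R}. norm (gcoeff f a) * \<rho> powr a)"
    using assms(1) finite_gcoeff_less by (intro sum_mono2) auto
  also have "\<dots> = wnorm \<rho> R f"
    using assms finite_gcoeff_less by (intro wnorm_altdef[symmetric]) auto
  finally show ?thesis .
qed

lemma wnorm_mono:
  assumes "R \<le> R'"
  shows "wnorm \<rho> R f \<le> wnorm \<rho> R' f"
  unfolding wnorm_def[of \<rho> R] using assms by (intro wnorm_ge_sum finite_gcoeff_less) auto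

lemma wnorm_bound:
  assumes "C \<ge> 0" "\<And>a. a < R \<Longrightarrow> norm (gcoeff f a) \<le> C * norm (gcoeff g a)"
  shows "wnorm \<rho> R f \<le> C * wnorm \<rho> R g"
proof -
  let ?F = "{a. gcoeff f a \<noteq> 0 \<and> a < R} \<union> {a. gcoeff g a \<noteq> 0 \<and> a < R}"
  have F: "finite ?F" using finite_gcoeff_less by simp
  have "wnorm \<rho> R f = (\<Sum>a\<in>?F. norm (gcoeff f a) * \<rho> powr a)" using F by (intro wnorm_altdef) auto
  also have "\<dots> \<le> (\<Sum>a\<in>?F. C * norm (gcoeff g a) * \<rho> powr a)"
    using assms(2) by (intro sum_mono mult_right_mono) auto
  also have "\<dots> = C * (\<Sum>a\<in>?F. norm (gcoeff g a) * \<rho> powr a)"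
    by (simp add: sum_distrib_left mult.assoc)
  also have "(\<Sum>a\<in>?F. norm (gcoeff g a) * \<rho> powr a) = wnorm \<rho> R g"
    using F by (intro wnorm_altdef[symmetric]) auto
  finally show ?thesis .
qed

lemma wnorm_add: "wnorm \<rho> R (f + g) \<le> wnorm \<rho> R f + wnorm \<rho> R g"
proof -
  let ?F = "{a. gcoeff f a \<noteq> 0 \<and> a < R} \<union> {a. gcoeff g a \<noteq> 0 \<and> a < R}"
  have F: "finite ?F" using finite_gcoeff_less by simp
  have "wnorm \<rho> R (f + g) = (\<Sum>a\<in>?F. norm (gcoeff (f + g) a) * \<rho> powr a)"
    using F by (intro wnorm_altdef) auto
  also have "\<dots> \<le> (\<Sum>a\<in>?F. norm (gcoeff f a) * \<rho> powr a + norm (gcoeff g a) * \<rho> powr a)"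
    by (intro sum_mono) (simp add: distrib_right[symmetric] mult_right_mono norm_triangle_ineq)
  also have "\<dots> = wnorm \<rho> R f + wnorm \<rho> R g"
    unfolding sum.distrib using F by (intro arg_cong2[of _ _ _ _ "(+)"] wnorm_altdef[symmetric]) auto
  finally show ?thesis .
qed

lemma wnorm_0 [simp]: "wnorm \<rho> R 0 = 0"
  by (simp add: wnorm_def)

lemma wnorm_sum: "wnorm \<rho> R (sum F S) \<le> (\<Sum>i\<in>S. wnorm \<rho> R (F i))"
  by (induction S rule: infinite_finite_induct) (auto intro: order.trans[OF wnorm_add])

text \<open>Submultiplicativity with a gain in the cut-offs: coefficients of \<open>f\<close> from
  \<open>R - q\<close> on cannot reach exponents below \<open>R\<close>, since \<open>g\<close> has
  order at least \<open>q\<close>.\<close>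

lemma wnorm_mult:
  assumes "\<rho> > 0" "vanishes_below p f" "vanishes_below q g"
  shows "wnorm \<rho> R (f * g) \<le> wnorm \<rho> (R - q) f * wnorm \<rho> (R - p) g"
proof -
  let ?S = "{a. gcoeff (f * g) a \<noteq> 0 \<and> a < R}" and ?F = "{u. gcoeff f u \<noteq> 0 \<and> u < R - q}"
  have "wnorm \<rho> R (f * g) = (\<Sum>a\<in>?S. norm (gcoeff (f * g) a) * \<rho> powr a)"
    by (simp add: wnorm_def)
  also have "\<dots> \<le> (\<Sum>a\<in>?S. \<Sum>u\<in>?F. (norm (gcoeff f u) * \<rho> powr u) * (norm (gcoeff g (a - u)) * \<rho> powr (a - u)))"
  proof (rule sum_mono)
    fix a assume a: "a \<in> ?S"
    have "gcoeff (f * g) a = (\<Sum>u\<in>?F. gcoeff f u * gcoeff g (a - u))"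
      by (rule gcoeff_mult[OF finite_gcoeff_less])
        (use a vanishes_belowD[OF assms(3), of "a - u" for u] in \<open>force\<close>)
    then have "norm (gcoeff (f * g) a) * \<rho> powr a \<le> (\<Sum>u\<in>?F. norm (gcoeff f u * gcoeff g (a - u))) * \<rho> powr a"
      by (simp add: mult_right_mono norm_sum)
    also have "\<dots> = (\<Sum>u\<in>?F. (norm (gcoeff f u) * \<rho> powr u) * (norm (gcoeff g (a - u)) * \<rho> powr (a - u)))"
      unfolding sum_distrib_right using assms(1)
      by (intro sum.cong refl) (simp add: norm_mult mult_ac flip: powr_add)
    finally show "norm (gcoeff (f * g) a) * \<rho> powr a \<le> \<dots>" .
  qed
  also have "\<dots> = (\<Sum>u\<in>?F. (norm (gcoeff f u) * \<rho> powr u) * (\<Sum>a\<in>?S. norm (gcoeff g (a - u)) * \<rho> powr (a - u)))"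
    by (subst sum.swap) (simp add: sum_distrib_left)
  also have "\<dots> \<le> (\<Sum>u\<in>?F. (norm (gcoeff f u) * \<rho> powr u) * wnorm \<rho> (R - p) g)"
  proof (intro sum_mono mult_left_mono)
    fix u assume u: "u \<in> ?F"
    have "(\<Sum>a\<in>?S. norm (gcoeff g (a - u)) * \<rho> powr (a - u))
        = (\<Sum>b\<in>(\<lambda>a. a - u) ` ?S. norm (gcoeff g b) * \<rho> powr b)"
      by (subst sum.reindex) (auto simp: inj_on_def)
    also have "\<dots> \<le> wnorm \<rho> (R - p) g"
    proof (rule wnorm_ge_sum)
      have "p \<le> u" using u assms(2) vanishes_belowD by blast
      then show "b < R - p" if "b \<in> (\<lambda>a. a - u) ` ?S" for b using that by auto
    qed (intro finite_imageI finite_gcoeff_less)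
    finally show "(\<Sum>a\<in>?S. norm (gcoeff g (a - u)) * \<rho> powr (a - u)) \<le> wnorm \<rho> (R - p) g" .
  qed simp
  also have "\<dots> = wnorm \<rho> (R - q) f * wnorm \<rho> (R - p) g"
    by (simp add: wnorm_def[of \<rho> "R - q"] sum_distrib_right)
  finally show ?thesis .
qed

lemma wnorm_power:
  assumes "\<rho> > 0" "vanishes_below 0 f"
  shows "wnorm \<rho> R (f ^ k) \<le> wnorm \<rho> R f ^ k"
proof (induction k)
  case 0
  have "wnorm \<rho> R 1 \<le> (\<Sum>a\<in>{0}. norm (gcoeff 1 a) * \<rho> powr a)"
    unfolding wnorm_def by (intro sum_mono2) (auto simp: gcoeff_1 split: if_splits)
  then show ?case using assms by (simp add: gcoeff_1)
next
  case (Suc k)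
  have "vanishes_below 0 (f ^ k)" using vanishes_below_power[OF assms(2), of k] by simp
  then have "wnorm \<rho> R (f * f ^ k) \<le> wnorm \<rho> R f * wnorm \<rho> R (f ^ k)"
    using wnorm_mult[OF assms, of 0 "f ^ k" R] by simp
  also have "\<dots> \<le> wnorm \<rho> R f * wnorm \<rho> R f ^ k"
    by (intro mult_left_mono Suc wnorm_nonneg)
  finally show ?case by simp
qed

text \<open>Meaningful for finite support only; a sum over an infinite set would be 0 by
  convention.\<close>

definition csum :: "gps \<Rightarrow> real" where
  "csum f = (\<Sum>a\<in>{a. gcoeff f a \<noteq> 0}. norm (gcoeff f a))"

lemma csum_nonneg: "csum f \<ge> 0"
  unfolding csum_def by (intro sum_nonneg) simp

lemma wnorm_fin_supp:
  assumes "fin_supp f" "vanishes_below p f" "0 < \<rho>" "\<rho> \<le> 1"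
  shows "wnorm \<rho> R f \<le> \<rho> powr p * csum f"
proof -
  have "wnorm \<rho> R f \<le> (\<Sum>a\<in>{a. gcoeff f a \<noteq> 0}. norm (gcoeff f a) * \<rho> powr a)"
    unfolding wnorm_def using assms(1) by (intro sum_mono2) (auto simp: fin_supp_def)
  also have "\<dots> \<le> (\<Sum>a\<in>{a. gcoeff f a \<noteq> 0}. norm (gcoeff f a) * \<rho> powr p)"
    using assms vanishes_belowD[OF assms(2)] by (intro sum_mono mult_left_mono powr_mono') auto
  finally show ?thesis by (simp add: csum_def sum_distrib_left mult.commute)
qed

text \<open>The majorant argument: since all coefficients \<open>e k l\<close> other than \<open>e 0 0\<close> have order at least
  \<open>\<epsilon>\<close>, the norm of \<open>x V' + (\<nu> - \<sigma>) V\<close> up to exponent \<open>R\<close> is controlled by that up to \<open>R - \<epsilon>\<close>.\<close>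

lemma wnorm_tail_bounded:
  assumes "\<epsilon> > 0" "\<nu> \<ge> 1" "\<nu> \<ge> 1 + \<sigma>" "vanishes_below 0 V"
    and eqn: "\<And>a. of_real (a + \<nu> - \<sigma>) * gcoeff V a =
       gcoeff (\<Sum>k\<le>n. \<Sum>l\<le>n. e k l * (V ^ k * gdiff (\<lambda>a. a + \<nu>) V ^ l)) a"
    and fin: "\<And>k l. fin_supp (e k l)"
    and e: "\<And>k l. (k, l) \<noteq> (0, 0) \<Longrightarrow> k \<le> n \<Longrightarrow> l \<le> n \<Longrightarrow> vanishes_below \<epsilon> (e k l)"
    and e00: "vanishes_below 0 (e 0 0)"
  shows "\<exists>\<rho> M. 0 < \<rho> \<and> \<rho> \<le> 1 \<and> (\<forall>R. wnorm \<rho> R V \<le> M)"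
proof -
  define W where "W = gdiff (\<lambda>a. a + \<nu>) V"
  \<comment> \<open>\<open>Y\<close> is \<open>x V' + (\<nu> - \<sigma>) V\<close>, so it dominates
    both \<open>V\<close> and \<open>W\<close> coefficientwise, and one quantity carries the
    induction.\<close>
  define Y where "Y = (\<Sum>k\<le>n. \<Sum>l\<le>n. e k l * (V ^ k * W ^ l))"
  have Y: "gcoeff Y a = of_real (a + \<nu> - \<sigma>) * gcoeff V a" for a
    by (simp only: eqn Y_def W_def)
  have W: "gcoeff W a = of_real (a + \<nu>) * gcoeff V a" for a
    by (simp add: W_def gcoeff_gdiff)
  have W0: "vanishes_below 0 W" unfolding W_def by (rule vanishes_below_gdiff) fact
  have Y0: "vanishes_below 0 Y" using assms(4) by (simp add: vanishes_below_def Y)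
  \<comment> \<open>From \<open>a + \<nu> - \<sigma> \<ge> 1\<close> follows \<open>a + \<nu> \<le>
    (1 + \<bar>\<sigma>\<bar>) (a + \<nu> - \<sigma>)\<close>.\<close>
  define C where "C = 1 + \<bar>\<sigma>\<bar>"
  \<comment> \<open>The constant term of the equation, plus room of size 1 for all other
    terms.\<close>
  define M where "M = csum (e 0 0) + 1"
  have C: "C \<ge> 1" and M: "M \<ge> 1" using csum_nonneg[of "e 0 0"] by (simp_all add: C_def M_def)
  have V_le: "norm (gcoeff V a) \<le> 1 * norm (gcoeff Y a)" for a
  proof (cases "gcoeff V a = 0")
    case False
    then have "a \<ge> 0" using assms(4) vanishes_belowD by blast
    then have "1 \<le> norm (complex_of_real (a + \<nu> - \<sigma>))" using assms(3) unfolding norm_of_real by linarith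
    then show ?thesis unfolding Y norm_mult using mult_right_mono[of 1 _ "norm (gcoeff V a)"] by simp
  qed simp
  have W_le: "norm (gcoeff W a) \<le> C * norm (gcoeff Y a)" for a
  proof (cases "gcoeff V a = 0")
    case False
    then have a: "a \<ge> 0" using assms(4) vanishes_belowD by blast
    have "\<bar>\<sigma>\<bar> * 1 \<le> \<bar>\<sigma>\<bar> * (a + \<nu> - \<sigma>)" using a assms(3) by (intro mult_left_mono) linarith+
    moreover have "C * (a + \<nu> - \<sigma>) = (a + \<nu> - \<sigma>) + \<bar>\<sigma>\<bar> * (a + \<nu> - \<sigma>)"
      unfolding C_def by (simp only: distrib_right mult_1_left)
    moreover have "a + \<nu> \<le> (a + \<nu> - \<sigma>) + \<bar>\<sigma>\<bar> * 1" by simp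
    ultimately have "a + \<nu> \<le> C * (a + \<nu> - \<sigma>)" by (metis add_left_mono order.trans)
    then have "norm (complex_of_real (a + \<nu>)) \<le> C * norm (complex_of_real (a + \<nu> - \<sigma>))"
      using a assms(2,3) unfolding norm_of_real by simp
    then show ?thesis unfolding W Y norm_mult
      by (metis mult.assoc mult_right_mono norm_ge_zero)
  qed (use C in \<open>simp add: W\<close>)
  \<comment> \<open>The total size of the nonconstant terms when \<open>V\<close> and
    \<open>W\<close> have norm at most \<open>C * M\<close>, apart from the factor
    \<open>\<rho> powr \<epsilon>\<close>.\<close>
  define D where "D = (\<Sum>k\<le>n. \<Sum>l\<le>n. if (k, l) = (0, 0) then 0 else csum (e k l) * (C * M) ^ (k + l))"
  have D: "D \<ge> 0" unfolding D_def using C M csum_nonneg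
    by (intro sum_nonneg) auto
  \<comment> \<open>This radius makes \<open>\<rho> powr \<epsilon> * D \<le> 1\<close>, so the
    nonconstant terms fit into the room left in \<open>M\<close>.\<close>
  define \<rho> where "\<rho> = (1 / (1 + D)) powr (1 / \<epsilon>)"
  have \<rho>: "0 < \<rho>" "\<rho> \<le> 1" "\<rho> powr \<epsilon> = 1 / (1 + D)"
    using D assms(1) by (auto simp: \<rho>_def powr_powr intro!: powr_le1)
  have step: "wnorm \<rho> (of_nat m * \<epsilon>) Y \<le> M" for m
  proof (induction m)
    case 0
    have "{a. gcoeff Y a \<noteq> 0 \<and> a < 0} = {}" using Y0 by (auto simp: vanishes_below_def)
    then have "wnorm \<rho> 0 Y = 0" by (simp only: wnorm_def sum.empty)
    then show ?case using M by simp
  next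
    case (Suc m)
    define R where "R = of_nat m * \<epsilon>"
    have R: "of_nat (Suc m) * \<epsilon> = R + \<epsilon>" by (simp add: R_def algebra_simps)
    have "wnorm \<rho> R V \<le> 1 * wnorm \<rho> R Y" by (intro wnorm_bound V_le) simp
    with Suc have VM: "wnorm \<rho> R V \<le> M" by (simp add: R_def)
    have "wnorm \<rho> R W \<le> C * wnorm \<rho> R Y" using C by (intro wnorm_bound W_le) simp
    also have "\<dots> \<le> C * M" using C Suc by (intro mult_left_mono) (simp_all add: R_def)
    finally have WM: "wnorm \<rho> R W \<le> C * M" .
    have "M \<le> C * M" using C M by simp
    with VM have VM': "wnorm \<rho> R V \<le> C * M" by linarith
    have summand: "wnorm \<rho> (R + \<epsilon>) (e k l * (V ^ k * W ^ l)) \<le>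
        (if (k, l) = (0, 0) then csum (e 0 0) else 0) +
        \<rho> powr \<epsilon> * (if (k, l) = (0, 0) then 0 else csum (e k l) * (C * M) ^ (k + l))"
      if kl: "k \<le> n" "l \<le> n" for k l
    proof (cases "(k, l) = (0, 0)")
      case True
      then show ?thesis using wnorm_fin_supp[OF fin e00 \<rho>(1,2)] \<rho> by simp
    next
      case False
      have Vk: "vanishes_below 0 (V ^ k)" and Wl: "vanishes_below 0 (W ^ l)"
        using vanishes_below_power[OF assms(4), of k] vanishes_below_power[OF W0, of l] by simp_all
      then have VW: "vanishes_below 0 (V ^ k * W ^ l)" using vanishes_below_mult by fastforce
      have "wnorm \<rho> R (V ^ k * W ^ l) \<le> wnorm \<rho> R (V ^ k) * wnorm \<rho> R (W ^ l)"
        using wnorm_mult[OF \<rho>(1) Vk Wl, of R] by simp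
      also have "\<dots> \<le> wnorm \<rho> R V ^ k * wnorm \<rho> R W ^ l"
        by (intro mult_mono wnorm_power \<rho> assms(4) W0 wnorm_nonneg zero_le_power)
      also have "\<dots> \<le> (C * M) ^ k * (C * M) ^ l"
        using C M by (intro mult_mono power_mono VM' WM wnorm_nonneg zero_le_power) simp_all
      finally have 1: "wnorm \<rho> R (V ^ k * W ^ l) \<le> (C * M) ^ (k + l)" by (simp add: power_add)
      have "wnorm \<rho> (R + \<epsilon>) (e k l * (V ^ k * W ^ l)) \<le> wnorm \<rho> (R + \<epsilon>) (e k l) * wnorm \<rho> R (V ^ k * W ^ l)"
        using wnorm_mult[OF \<rho>(1) e[OF False kl] VW, of "R + \<epsilon>"] by simp
      also have "\<dots> \<le> (\<rho> powr \<epsilon> * csum (e k l)) * (C * M) ^ (k + l)"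
        by (intro mult_mono 1 wnorm_fin_supp fin e[OF False kl] \<rho> wnorm_nonneg mult_nonneg_nonneg csum_nonneg) simp
      finally show ?thesis unfolding if_not_P[OF False] by (simp only: mult.assoc add_0_left)
    qed
    have "wnorm \<rho> (R + \<epsilon>) Y \<le> (\<Sum>k\<le>n. \<Sum>l\<le>n. wnorm \<rho> (R + \<epsilon>) (e k l * (V ^ k * W ^ l)))"
      unfolding Y_def by (rule order.trans[OF wnorm_sum]) (intro sum_mono wnorm_sum)
    also have "\<dots> \<le> (\<Sum>k\<le>n. \<Sum>l\<le>n. (if (k, l) = (0, 0) then csum (e 0 0) else 0) +
        \<rho> powr \<epsilon> * (if (k, l) = (0, 0) then 0 else csum (e k l) * (C * M) ^ (k + l)))"
      by (intro sum_mono summand) simp_all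
    also have "\<dots> = (\<Sum>k\<le>n. \<Sum>l\<le>n. (if l = 0 then if k = 0 then csum (e 0 0) else 0 else 0)) + \<rho> powr \<epsilon> * D"
      unfolding sum.distrib D_def sum_distrib_left
      by (intro arg_cong2[of _ _ _ _ "(+)"] sum.cong refl) simp_all
    also have "(\<Sum>k\<le>n. \<Sum>l\<le>n. (if l = 0 then if k = 0 then csum (e 0 0) else 0 else 0)) = csum (e 0 0)"
      by simp
    also have "csum (e 0 0) + \<rho> powr \<epsilon> * D \<le> M"
      using D by (simp add: \<rho>(3) M_def field_simps)
    finally show ?case unfolding R .
  qed
  have "wnorm \<rho> R V \<le> M" for R
  proof -
    obtain m where "R < of_nat m * \<epsilon>" using reals_Archimedean3[OF assms(1)] by blast
    then have "wnorm \<rho> R V \<le> wnorm \<rho> (of_nat m * \<epsilon>) V" by (intro wnorm_mono) simp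
    also have "\<dots> \<le> 1 * wnorm \<rho> (of_nat m * \<epsilon>) Y" by (intro wnorm_bound V_le) simp
    finally show ?thesis using step[of m] by simp
  qed
  with \<rho> show ?thesis by blast
qed

subsection \<open>Solutions are convergent Puiseux series\<close>

lemma gs_const_gcoeff: "gs_const c = gcoeff (gmonom c 0)"
  by (auto simp: gs_const_def gcoeff_gmonom)

lemma gs_pow_gcoeff: "gs_pow (gcoeff f) k = gcoeff (f ^ k)"
  by (induction k) (simp_all add: gs_pow_def gs_const_gcoeff gcoeff_times)

lemma ex_degree_bound:
  fixes P :: "complex poly poly"
  obtains n where "n \<ge> 1" "degree P \<le> n" "\<And>j. degree (coeff P j) \<le> n"
proof -
  define n where "n = 1 + degree P + (\<Sum>j\<le>degree P. degree (coeff P j))"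
  have "degree (coeff P j) \<le> n" for j
  proof (cases "j \<le> degree P")
    case True
    then have "degree (coeff P j) \<le> (\<Sum>j\<le>degree P. degree (coeff P j))"
      by (intro member_le_sum) auto
    then show ?thesis by (simp add: n_def)
  qed (simp add: coeff_eq_0)
  then show ?thesis by (intro that[of n]) (simp_all add: n_def)
qed

lemma is_solution_iff_taylor:
  assumes "degree P \<le> n" "\<And>j. degree (coeff P j) \<le> n"
  shows "is_solution P (gcoeff s) \<longleftrightarrow> taylor (\<lambda>i j. coeff (coeff P j) i) n 0 0 s (gderiv s) = 0"
proof -
  have "gs_eval P (gcoeff s) (gs_deriv (gcoeff s)) \<mu> = gcoeff (taylor (\<lambda>i j. coeff (coeff P j) i) n 0 0 s (gderiv s)) \<mu>" for \<mu>
  proof -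
    have "gs_eval P (gcoeff s) (gs_deriv (gcoeff s)) \<mu> =
      (\<Sum>j\<le>degree P. \<Sum>i\<le>degree (coeff P j). coeff (coeff P j) i * gcoeff (s ^ i * gderiv s ^ j) \<mu>)"
      by (simp add: gs_eval_def gs_deriv_gcoeff gs_pow_gcoeff gcoeff_times)
    also have "\<dots> = (\<Sum>j\<le>degree P. \<Sum>i\<le>n. coeff (coeff P j) i * gcoeff (s ^ i * gderiv s ^ j) \<mu>)"
      using assms(2) by (intro sum.cong refl sum.mono_neutral_left) (auto simp: coeff_eq_0)
    also have "\<dots> = (\<Sum>j\<le>n. \<Sum>i\<le>n. coeff (coeff P j) i * gcoeff (s ^ i * gderiv s ^ j) \<mu>)"
      using assms(1) by (intro sum.mono_neutral_left) (auto simp: coeff_eq_0)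
    also have "\<dots> = (\<Sum>i\<le>n. \<Sum>j\<le>n. coeff (coeff P j) i * gcoeff (s ^ i * gderiv s ^ j) \<mu>)"
      by (rule sum.swap)
    also have "\<dots> = gcoeff (taylor (\<lambda>i j. coeff (coeff P j) i) n 0 0 s (gderiv s)) \<mu>"
      by (simp add: taylor_def mult.assoc gcoeff_gmonom_mult)
    finally show ?thesis .
  qed
  then show ?thesis unfolding is_solution_def
    by (metis gcoeff_0 gps_eqI ext)
qed

lemma is_conv_puiseux_const:
  assumes "\<And>a. a \<noteq> 0 \<Longrightarrow> gcoeff s a = 0"
  shows "is_conv_puiseux (gcoeff s)"
  unfolding is_conv_puiseux_def
proof (intro conjI exI[of _ "1::nat"] exI[of _ "1::real"] allI impI)
  show "gcoeff s \<in> Omega" by (rule gcoeff)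
  show "\<exists>k::int. \<mu> = of_int k / real 1" if "gcoeff s \<mu> \<noteq> 0" for \<mu>
    using that assms[of \<mu>] by (intro exI[of _ 0]) auto
  show "summable (\<lambda>n. norm (gcoeff s (real n / real 1)) * 1 ^ n)"
    by (rule summable_finite[of "{0}"]) (simp_all add: assms)
qed simp_all

lemma solution_is_conv_puiseux:
  assumes "P \<noteq> 0" "is_solution P (gcoeff s)"
  shows "is_conv_puiseux (gcoeff s)"
proof (cases "gderiv s = 0")
  case True
  have "gcoeff s a = 0" if "a \<noteq> 0" for a
  proof -
    have "gcoeff (gderiv s) (a - 1) = 0" using True by simp
    then show ?thesis using that by (simp add: gcoeff_gderiv)
  qed
  then show ?thesis by (rule is_conv_puiseux_const)
next
  case False
  obtain n where n: "n \<ge> 1" "degree P \<le> n" "\<And>j. degree (coeff P j) \<le> n"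
    using ex_degree_bound[of P] by blast
  define c0 where "c0 i j = coeff (coeff P j) i" for i j
  have sol0: "taylor c0 n 0 0 s (gderiv s) = 0"
    using is_solution_iff_taylor[OF n(2,3)] assms(2) by (simp add: c0_def[abs_def])
  obtain j i where ij: "coeff (coeff P j) i \<noteq> 0" using assms(1) by (metis leading_coeff_0_iff)
  then have "i \<le> n" using n(3)[of j] le_degree[of "coeff P j" i] by simp
  with ij have nonzero: "\<exists>i j. i \<le> n \<and> c0 i j \<noteq> 0" by (auto simp: c0_def)
  have "c0 i j = 0" if "n < j" for i j using n(2) that by (simp add: c0_def coeff_eq_0)
  with ex_nondegenerate[OF nonzero, of n s "gderiv s"] sol0 False
  obtain c where sol: "taylor c n 0 0 s (gderiv s) = 0" and nondeg: "taylor c n 0 1 s (gderiv s) \<noteq> 0"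
    by auto
  obtain \<sigma> where \<sigma>: "gcoeff (gderiv s) \<sigma> \<noteq> 0" "vanishes_below \<sigma> (gderiv s)"
    using gps_nonzero_leading[OF False] by blast
  show ?thesis
  proof (rule tail_equation[OF n(1) sol nondeg \<sigma>])
    fix \<nu> \<epsilon> e V
    assume eq: "\<epsilon> > 0" "\<nu> \<in> \<rat>" "\<nu> \<ge> 1" "\<nu> \<ge> 1 + \<sigma>"
      "s = head \<nu> s + gmonom 1 \<nu> * V" "vanishes_below 0 V"
      "\<And>a. of_real (a + \<nu> - \<sigma>) * gcoeff V a =
         gcoeff (\<Sum>k\<le>n. \<Sum>l\<le>n. e k l * (V ^ k * gdiff (\<lambda>a. a + \<nu>) V ^ l)) a"
      "\<And>k l. fin_supp (e k l)"
      "\<And>k l. (k, l) \<noteq> (0, 0) \<Longrightarrow> k \<le> n \<Longrightarrow> l \<le> n \<Longrightarrow> vanishes_below \<epsilon> (e k l)"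
      "vanishes_below 0 (e 0 0)"
      "\<And>k l. supp_in \<rat> s \<Longrightarrow> supp_in \<rat> (e k l)"
    have rat: "supp_in \<rat> s" by (rule supp_in_Rats[OF sol nondeg False])
    \<comment> \<open>All exponents that generate those of \<open>s\<close>: the cut-off, the
      truncation and the coefficients of the tail equation. The set is finite and rational, so it
      has a common denominator.\<close>
    define F where "F = {\<nu>} \<union> {a. gcoeff (head \<nu> s) a \<noteq> 0} \<union> (\<Union>k\<le>n. \<Union>l\<le>n. {a. gcoeff (e k l) a \<noteq> 0})"
    have "finite F" using fin_supp_head[of \<nu> s] eq(8) by (auto simp: F_def fin_supp_def)
    moreover have "F \<subseteq> \<rat>"
      using rat eq(2) eq(11)[OF rat] by (auto simp: F_def supp_in_def gcoeff_head split: if_splits)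
    ultimately obtain d :: nat where d: "d \<ge> 1" "\<And>x. x \<in> F \<Longrightarrow> \<exists>k::int. x = of_int k / of_nat d"
      using common_denominator by metis
    then have F: "F \<subseteq> fractions d" by (auto simp: fractions_def)
    note ac = add_closed_fractions[OF d(1)]
    have "supp_in (fractions d) V"
      by (rule supp_in_tail[OF eq(1,4,6,7,9) ac]) (use F in \<open>auto simp: F_def supp_in_def\<close>)
    moreover have "\<nu> \<in> fractions d" "supp_in (fractions d) (head \<nu> s)"
      using F by (auto simp: F_def supp_in_def)
    ultimately have "supp_in (fractions d) (head \<nu> s + gmonom 1 \<nu> * V)"
      using ac by (intro supp_in_add supp_in_mult supp_in_gmonom)
    then have supp: "supp_in (fractions d) s" using eq(5) by simp
    obtain \<rho> M where \<rho>: "0 < \<rho>" "\<rho> \<le> 1" and M: "\<And>R. wnorm \<rho> R V \<le> M"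
      using wnorm_tail_bounded[OF eq(1,3,4,6,7,8,9,10)] by auto
    obtain m where m: "vanishes_below m (head \<nu> s)" using ex_vanishes_below by blast
    define K where "K = \<rho> powr m * csum (head \<nu> s) + \<rho> powr \<nu> * csum (gmonom 1 \<nu>) * M"
    have K: "wnorm \<rho> R s \<le> K" for R
    proof -
      have "wnorm \<rho> R (gmonom 1 \<nu> * V) \<le> wnorm \<rho> (R - 0) (gmonom 1 \<nu>) * wnorm \<rho> (R - \<nu>) V"
        by (intro wnorm_mult \<rho> vanishes_below_gmonom eq(6))
      also have "\<dots> \<le> (\<rho> powr \<nu> * csum (gmonom 1 \<nu>)) * M"
        by (intro mult_mono wnorm_fin_supp fin_supp_gmonom vanishes_below_gmonom \<rho> M wnorm_nonneg mult_nonneg_nonneg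
            csum_nonneg) simp
      finally have "wnorm \<rho> R (gmonom 1 \<nu> * V) \<le> \<dots>" .
      moreover have "wnorm \<rho> R (head \<nu> s) \<le> \<rho> powr m * csum (head \<nu> s)"
        by (intro wnorm_fin_supp fin_supp_head m \<rho>)
      moreover have "wnorm \<rho> R s \<le> wnorm \<rho> R (head \<nu> s) + wnorm \<rho> R (gmonom 1 \<nu> * V)"
        using wnorm_add[of \<rho> R "head \<nu> s" "gmonom 1 \<nu> * V"] eq(5) by simp
      ultimately show ?thesis by (simp add: K_def)
    qed
    \<comment> \<open>With \<open>x^(1/d)\<close> as parameter, radius \<open>\<rho>\<close> in
      \<open>x\<close> becomes \<open>r\<close>, and partial sums of the power series part are
      bounded by weighted norms of truncations.\<close>
    define r where "r = \<rho> powr (1 / of_nat d)"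
    have r: "r > 0" using \<rho> by (simp add: r_def)
    have "summable (\<lambda>n. norm (gcoeff s (real n / real d)) * r ^ n)"
    proof (rule summableI_nonneg_bounded)
      fix N
      have pow: "r ^ i = \<rho> powr (real i / real d)" for i
        using \<rho> d(1) by (simp add: r_def powr_realpow[symmetric] powr_powr)
      have "(\<Sum>i<N. norm (gcoeff s (real i / real d)) * r ^ i)
        = (\<Sum>a\<in>(\<lambda>i. real i / real d) ` {..<N}. norm (gcoeff s a) * \<rho> powr a)"
        using d(1) by (subst sum.reindex) (auto simp: inj_on_def pow)
      also have "\<dots> \<le> wnorm \<rho> (real N / real d) s"
        using d(1) by (intro wnorm_ge_sum) (auto simp: divide_strict_right_mono)
      finally show "(\<Sum>i<N. norm (gcoeff s (real i / real d)) * r ^ i) \<le> K" using K by (meson order.trans)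
    qed (use r in simp)
    then show "is_conv_puiseux (gcoeff s)"
      unfolding is_conv_puiseux_def using d(1) r supp gcoeff[of s]
      by (auto simp: supp_in_def fractions_def)
  qed
qed

lemma is_conv_puiseux_imp_is_puiseux: "is_conv_puiseux s \<Longrightarrow> is_puiseux s"
  by (auto simp: is_conv_puiseux_def is_puiseux_def)

subsection \<open>Puiseux's theorem: existence of one root\<close>

unbundle no vec_syntax and fps_syntax

section \<open>Coefficient homomorphisms on polynomials\<close>

lemma map_poly_mult_hom:
  fixes h :: "'a::comm_ring_1 \<Rightarrow> 'b::comm_ring_1"
  assumes "h 0 = 0" "\<And>a b. h (a + b) = h a + h b" "\<And>a b. h (a * b) = h a * h b"
  shows "map_poly h (p * q) = map_poly h p * map_poly h q"
proof (rule poly_eqI)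
  have sum: "h (sum F S) = (\<Sum>i\<in>S. h (F i))" for F :: "nat \<Rightarrow> 'a" and S
    by (induction S rule: infinite_finite_induct) (simp_all add: assms)
  show "coeff (map_poly h (p * q)) n = coeff (map_poly h p * map_poly h q) n" for n
    by (simp add: coeff_map_poly assms coeff_mult sum)
qed

lemma map_poly_add_hom:
  assumes "h 0 = 0" "\<And>a b. h (a + b) = h a + h b"
  shows "map_poly h (p + q) = map_poly h p + map_poly h q"
  by (rule poly_eqI) (simp add: coeff_map_poly assms)

lemma map_poly_pcompose_hom:
  fixes h :: "'a::comm_ring_1 \<Rightarrow> 'b::comm_ring_1"
  assumes "h 0 = 0" "\<And>a b. h (a + b) = h a + h b" "\<And>a b. h (a * b) = h a * h b"
  shows "map_poly h (pcompose p q) = pcompose (map_poly h p) (map_poly h q)"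
  by (induction p)
    (simp_all add: pcompose_pCons map_poly_add_hom[OF assms(1,2)] map_poly_mult_hom[OF assms] map_poly_pCons assms(1))

text \<open>Divided differences. Both arguments vanish modulo \<open>fps_X\<close>, so the quotient
  reduces to the derivative of \<open>p\<close> at 0.\<close>

lemma poly_difference_factor:
  fixes p :: "'a::comm_ring_1 fps poly"
  assumes "v $ 0 = 0" "w $ 0 = 0"
  shows "\<exists>h. poly p v - poly p w = (v - w) * h \<and> h $ 0 = coeff p 1 $ 0"
proof -
  have ex: "\<exists>h. poly p v - poly p w = (v - w) * h" for p :: "'a fps poly"
  proof (induction p)
    case (pCons a p)
    then obtain h where "poly p v - poly p w = (v - w) * h" by blast
    then have "poly (pCons a p) v - poly (pCons a p) w = (v - w) * (poly p v + w * h)"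
      by (simp add: algebra_simps) (metis (no_types, lifting) add_diff_cancel_left' diff_add_cancel distrib_left mult.left_commute right_diff_distrib)
    then show ?case by blast
  qed (auto intro: exI[of _ 0])
  have const: "poly p v $ 0 = coeff p 0 $ 0" for p :: "'a fps poly"
    using assms(1) by (cases p) simp
  show ?thesis
  proof (cases p)
    case (pCons a r)
    obtain h where h: "poly r v - poly r w = (v - w) * h" using ex by blast
    have "poly p v - poly p w = v * poly r v - w * poly r w" by (simp add: pCons)
    also have "\<dots> = (v - w) * poly r v + w * (poly r v - poly r w)" by (simp add: algebra_simps)
    also have "\<dots> = (v - w) * (poly r v + w * h)" by (simp add: h algebra_simps)
    finally show ?thesis using assms(2) const[of r] pCons
      by (intro exI[of _ "poly r v + w * h"]) simp
  qed
qed

text \<open>Hensel's lemma by a Newton iteration with the fixed slope \<open>\<alpha>\<close>: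
  successive differences are multiplied by \<open>1 - h / \<alpha>\<close>, whose constant term is
  0, so each step fixes one more coefficient.\<close>

lemma fps_simple_root:
  fixes p :: "'a::field fps poly"
  assumes "coeff p 0 $ 0 = 0" "coeff p 1 $ 0 \<noteq> 0"
  shows "\<exists>b. b $ 0 = 0 \<and> poly p b = 0"
proof -
  define \<alpha> where "\<alpha> = coeff p 1 $ 0"
  define v where "v = rec_nat 0 (\<lambda>_ v. v - fps_const (1 / \<alpha>) * poly p v)"
  have v_Suc: "v (Suc k) = v k - fps_const (1 / \<alpha>) * poly p (v k)" for k by (simp add: v_def)
  have const: "poly p x $ 0 = 0" if "x $ 0 = 0" for x
    using assms(1) that by (cases p) simp
  have v0: "v k $ 0 = 0" for k
    by (induction k) (simp_all add: v_Suc const, simp add: v_def)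
  have close: "(v (Suc k) - v k) $ i = 0" if "i \<le> k" for i k
    using that
  proof (induction k arbitrary: i)
    case 0
    then show ?case using v0 by simp
  next
    case (Suc k)
    obtain h where h: "poly p (v (Suc k)) - poly p (v k) = (v (Suc k) - v k) * h" "h $ 0 = \<alpha>"
      using poly_difference_factor[OF v0 v0] unfolding \<alpha>_def by blast
    have "v (Suc (Suc k)) - v (Suc k) = (v (Suc k) - v k) - fps_const (1 / \<alpha>) * (poly p (v (Suc k)) - poly p (v k))"
      by (subst (1) v_Suc, subst (2) v_Suc) (simp add: algebra_simps)
    also have "\<dots> = (v (Suc k) - v k) * (1 - fps_const (1 / \<alpha>) * h)"
      by (simp add: h algebra_simps)
    also have "\<dots> $ i = 0"
      unfolding fps_mult_nth
    proof (rule sum.neutral, rule ballI)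
      fix j assume "j \<in> {0..i}"
      then show "(v (Suc k) - v k) $ j * (1 - fps_const (1 / \<alpha>) * h) $ (i - j) = 0"
        using Suc.IH[of j] Suc.prems h(2) assms(2) by (cases "j \<le> k") (auto simp: \<alpha>_def)
    qed
    finally show ?case .
  qed
  \<comment> \<open>The limit of the iteration, taken diagonally: coefficient \<open>i\<close> no
    longer changes from step \<open>i\<close> on.\<close>
  define b where "b = Abs_fps (\<lambda>i. v i $ i)"
  have stable: "v (i + k) $ i = v i $ i" for i k
  proof (induction k)
    case (Suc k)
    then show ?case using close[of i "i + k"] by simp
  qed simp
  have b: "(b - v k) $ i = 0" if "i \<le> k" for i k
    using stable[of i "k - i"] that by (simp add: b_def)
  have b0: "b $ 0 = 0" by (simp add: b_def v0)
  have "poly p b $ k = 0" for k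
  proof -
    obtain h where h: "poly p b - poly p (v k) = (b - v k) * h"
      using poly_difference_factor[OF b0 v0] by blast
    have "((b - v k) * h) $ k = 0"
      unfolding fps_mult_nth using b by (intro sum.neutral) auto
    then have "poly p b $ k = poly p (v k) $ k" by (simp flip: h)
    moreover have "(v (Suc k) - v k) $ k = - (1 / \<alpha>) * poly p (v k) $ k" by (simp add: v_Suc)
    ultimately show ?thesis using close[of k k] assms(2) by (simp add: \<alpha>_def)
  qed
  with b0 show ?thesis by (intro exI[of _ b]) (simp add: fps_eq_iff)
qed

text \<open>Substitution of the \<open>q\<close>-th power of a new parameter, that is, passage to a
  \<open>q\<close>-th root of the variable.\<close>

definition ramify :: "nat \<Rightarrow> complex fps \<Rightarrow> complex fps" where
  "ramify q a = a oo fps_X ^ q"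

lemma ramify_0 [simp]: "ramify q 0 = 0"
  by (simp add: ramify_def)

lemma ramify_hom:
  assumes "q \<ge> 1"
  shows "ramify q (a + b) = ramify q a + ramify q b" "ramify q (a * b) = ramify q a * ramify q b"
    "ramify q a $ 0 = a $ 0" "ramify q (fps_const c) = fps_const c"
  using assms by (simp_all add: ramify_def fps_compose_add_distrib fps_compose_mult_distrib)

lemma ramify_X_power: "q \<ge> 1 \<Longrightarrow> ramify q (fps_X ^ k) = fps_X ^ (q * k)"
  by (simp add: ramify_def fps_compose_power[symmetric] power_mult)

lemma ramify_ramify:
  assumes "p \<ge> 1" "q \<ge> 1"
  shows "ramify q (ramify p a) = ramify (p * q) a"
proof -
  have "ramify q (ramify p a) = a oo (fps_X ^ p oo fps_X ^ q)"
    unfolding ramify_def using assms by (intro fps_compose_assoc[symmetric]) simp_all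
  also have "fps_X ^ p oo fps_X ^ q = (fps_X ^ (p * q) :: complex fps)"
    using ramify_X_power[of q p] assms by (simp add: ramify_def mult.commute)
  finally show ?thesis by (simp add: ramify_def)
qed

lemma ramify_1 [simp]: "ramify (Suc 0) a = a"
  by (simp add: ramify_def)

lemma map_poly_ramify_ramify:
  assumes "p \<ge> 1" "q \<ge> 1"
  shows "map_poly (ramify q) (map_poly (ramify p) f) = map_poly (ramify (p * q)) f"
  by (rule poly_eqI) (simp add: coeff_map_poly ramify_ramify[OF assms])

lemma coeff_shift_root:
  fixes R :: "complex poly"
  assumes "R \<noteq> 0"
  shows "i < order c R \<Longrightarrow> coeff (pcompose R [:c, 1:]) i = 0"
    and "coeff (pcompose R [:c, 1:]) (order c R) \<noteq> 0"
proof -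
  obtain Q where Q: "R = [:- c, 1:] ^ order c R * Q" "\<not> [:- c, 1:] dvd Q"
    using order_decomp[OF assms] by blast
  have pow: "pcompose ([:- c, 1:] ^ k) [:c, 1:] = monom 1 k" for k
  proof (induction k)
    case (Suc k)
    have "pcompose ([:- c, 1:] ^ Suc k) [:c, 1:] = pcompose [:- c, 1:] [:c, 1:] * monom 1 k"
      by (simp only: power_Suc pcompose_mult Suc)
    also have "pcompose [:- c, 1:] [:c, 1:] = [:0, 1:]" by (simp add: pcompose_pCons)
    finally show ?case by (simp add: monom_Suc)
  qed (simp add: pcompose_1)
  have eq: "pcompose R [:c, 1:] = monom 1 (order c R) * pcompose Q [:c, 1:]"
    by (subst Q(1)) (simp add: pcompose_mult pow)
  show "i < order c R \<Longrightarrow> coeff (pcompose R [:c, 1:]) i = 0"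
    unfolding eq by (simp add: coeff_monom_mult)
  have "poly Q c \<noteq> 0" using Q(2) by (simp add: poly_eq_0_iff_dvd)
  then show "coeff (pcompose R [:c, 1:]) (order c R) \<noteq> 0"
    unfolding eq coeff_monom_mult by (simp add: poly_0_coeff_0[symmetric] poly_pcompose)
qed

text \<open>A root of full order would make \<open>R\<close> a multiple of \<open>(X - c)^m\<close>.
  The vanishing coefficient of degree \<open>m - 1\<close> then forces \<open>c = 0\<close>, leaving
  a monomial, against the nonzero coefficient of degree \<open>i\<close>.\<close>

lemma ex_root_of_smaller_order:
  fixes R :: "complex poly"
  assumes "degree R = m" "m \<ge> 1" "coeff R (m - 1) = 0" "i < m" "coeff R i \<noteq> 0"
  shows "\<exists>c. 1 \<le> order c R \<and> order c R < m"
proof -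
  have "R \<noteq> 0" using assms by auto
  have "\<not> constant (poly R)" using assms(1,2) by (simp add: constant_degree)
  then obtain c where c: "poly R c = 0" using fundamental_theorem_of_algebra by blast
  have "order c R \<noteq> m"
  proof
    assume m: "order c R = m"
    obtain Q where Q: "R = [:- c, 1:] ^ m * Q" using order_decomp[OF \<open>R \<noteq> 0\<close>, of c] m by auto
    then have "Q \<noteq> 0" using \<open>R \<noteq> 0\<close> by auto
    then have "degree R = m + degree Q" by (subst Q) (simp add: degree_mult_eq degree_linear_power)
    then obtain k where "Q = [:k:]" using assms(1) by (metis add_cancel_right_right degree_eq_zeroE)
    with Q \<open>Q \<noteq> 0\<close> have R: "R = smult k ([:- c, 1:] ^ m)" "k \<noteq> 0" by (simp_all add: mult.commute)
    have "coeff R (m - 1) = k * (of_nat (m choose (m - 1)) * (- c) ^ (m - (m - 1)))"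
      unfolding R(1) coeff_smult by (subst coeff_linear_poly_power) simp_all
    also have "m choose (m - 1) = m" using assms(2) binomial_symmetric[of "m - 1" m] by simp
    also have "m - (m - 1) = 1" using assms(2) by simp
    finally have "c = 0" using assms(2,3) R(2) by simp
    then have "coeff R i = k * (of_nat (m choose i) * 0 ^ (m - i))"
      unfolding R(1) coeff_smult using assms(4) by (subst coeff_linear_poly_power) simp_all
    then show False using assms(4,5) by simp
  qed
  moreover have "order c R \<le> m" using order_degree[OF \<open>R \<noteq> 0\<close>] assms(1) by blast
  moreover have "order c R \<noteq> 0" using c \<open>R \<noteq> 0\<close> by (simp add: order_root)
  ultimately show ?thesis by (intro exI[of _ c]) simp
qed

text \<open>Makes the coefficient of degree \<open>m - 1\<close> vanish, so that the reduction obtained after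
  rescaling by the Newton slope is not an \<open>m\<close>-th power.\<close>

lemma translate_to_trace_zero:
  fixes f :: "complex fps poly"
  assumes "\<And>i. i < m \<Longrightarrow> coeff f i $ 0 = 0" "coeff f m $ 0 \<noteq> 0" "m \<ge> 1"
  obtains b where "b $ 0 = 0" "coeff (pcompose f [:b, 1:]) (m - 1) = 0"
    "\<And>i. coeff (pcompose f [:b, 1:]) i $ 0 = coeff f i $ 0"
proof -
  \<comment> \<open>Up to nonzero factors, the first two coefficients of \<open>D\<close> are those
    of \<open>f\<close> of degrees \<open>m - 1\<close> and \<open>m\<close>. So \<open>D\<close>
    has a simple root modulo \<open>fps_X\<close>; translating by its lift \<open>b\<close> kills
    the coefficient of degree \<open>m - 1\<close>.\<close>
  define D where "D = (pderiv ^^ (m - 1)) f"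
  have poch: "(pochhammer (of_nat (Suc k)) j :: complex fps) = fps_const (pochhammer (of_nat (Suc k)) j)" for k j
    by (simp only: pochhammer_of_nat fps_of_nat)
  have poch_nz: "pochhammer (of_nat (Suc k)) j \<noteq> (0 :: complex)" for k j
    using pochhammer_pos[OF zero_less_Suc[of k], of j] by (simp only: pochhammer_of_nat of_nat_eq_0_iff)
  have D: "coeff D k $ 0 = pochhammer (of_nat (Suc k)) (m - 1) * coeff f (k + (m - 1)) $ 0" for k
    unfolding D_def coeff_higher_pderiv poch by (simp only: fps_mult_left_const_nth)
  have "coeff D 0 $ 0 = 0" unfolding D using assms(1)[of "m - 1"] assms(3) by simp
  moreover have "coeff D 1 $ 0 \<noteq> 0"
    unfolding D using assms(2,3) poch_nz[of 1 "m - 1"] by (simp del: of_nat_Suc)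
  ultimately obtain b where b: "b $ 0 = 0" "poly D b = 0" using fps_simple_root by blast
  have higher: "(pderiv ^^ k) (pcompose f [:b, 1:]) = pcompose ((pderiv ^^ k) f) [:b, 1:]" for k
    by (induction k) (simp_all add: pderiv_pcompose pderiv_pCons)
  have "coeff ((pderiv ^^ (m - 1)) (pcompose f [:b, 1:])) 0 = 0"
    unfolding higher using b(2) by (simp add: D_def poly_0_coeff_0[symmetric] poly_pcompose)
  then have "coeff (pcompose f [:b, 1:]) (m - 1) = 0"
    using poch_nz[of 0 "m - 1"] unfolding coeff_higher_pderiv poch by simp
  moreover have "coeff (pcompose f [:b, 1:]) i $ 0 = coeff f i $ 0" for i
  proof -
    have "map_poly (\<lambda>a. a $ 0) (pcompose f [:b, 1:]) = pcompose (map_poly (\<lambda>a. a $ 0) f) (map_poly (\<lambda>a. a $ 0) [:b, 1:])"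
      by (rule map_poly_pcompose_hom) simp_all
    also have "map_poly (\<lambda>a. a $ 0) [:b, 1:] = [:0, 1:]" using b(1) by (simp add: map_poly_pCons)
    finally have "coeff (map_poly (\<lambda>a. a $ 0) (pcompose f [:b, 1:])) i = coeff (map_poly (\<lambda>a. a $ 0) f) i" by simp
    then show ?thesis by (simp add: coeff_map_poly)
  qed
  ultimately show ?thesis using b(1) that by blast
qed

text \<open>The Newton polygon step. The minimal slope \<open>p / q\<close> among the coefficients
  below \<open>m\<close> determines the weight of the unknown; after ramification by
  \<open>q\<close> the substitution of \<open>fps_X ^ p\<close> times the unknown allows division by
  \<open>fps_X ^ (p * m)\<close>, and some coefficient below \<open>m\<close> becomes a
  unit.\<close>

lemma newton_rescaling:
  fixes f :: "complex fps poly"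
  assumes f: "\<And>i. i < m \<Longrightarrow> coeff f i $ 0 = 0" "coeff f m $ 0 \<noteq> 0"
    and tr: "coeff f (m - 1) = 0" and nz: "i < m" "coeff f i \<noteq> 0"
  obtains p q g i0 where "p \<ge> 1" "q \<ge> 1" "smult (fps_X ^ (p * m)) g = pcompose (map_poly (ramify q) f) [:0, fps_X ^ p:]"
    "\<And>k. k > m \<Longrightarrow> coeff g k $ 0 = 0" "coeff g m $ 0 \<noteq> 0" "coeff g (m - 1) $ 0 = 0"
    "i0 < m" "coeff g i0 $ 0 \<noteq> 0"
proof -
  let ?S = "{i. i < m \<and> coeff f i \<noteq> 0}" and ?slope = "\<lambda>i. real (subdegree (coeff f i)) / real (m - i)"
  have S: "finite ?S" "?S \<noteq> {}" using nz by auto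
  obtain i0 where i0: "is_arg_min ?slope (\<lambda>i. i \<in> ?S) i0" using ex_is_arg_min_if_finite[OF S] by blast
  then have i0': "i0 < m" "coeff f i0 \<noteq> 0" by (simp_all add: is_arg_min_def)
  have slope: "?slope i0 \<le> ?slope k" if "k < m" "coeff f k \<noteq> 0" for k
  proof -
    have "\<not> (k \<in> ?S \<and> ?slope k < ?slope i0)" using i0 unfolding is_arg_min_def by blast
    then show ?thesis using that by (simp only: mem_Collect_eq not_less simp_thms)
  qed
  define p where "p = subdegree (coeff f i0)"
  define q where "q = m - i0"
  have q: "q \<ge> 1" using i0' by (simp add: q_def)
  have "p \<noteq> 0" using f(1)[OF i0'(1)] i0'(2) unfolding p_def subdegree_eq_0_iff by simp
  then have p: "p \<ge> 1" by simp
  have ineq: "p * (m - k) \<le> q * subdegree (coeff f k)" if "k < m" "coeff f k \<noteq> 0" for k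
  proof -
    have "real p / real q \<le> real (subdegree (coeff f k)) / real (m - k)"
      using slope[OF that] by (simp add: p_def q_def)
    then have "real p * real (m - k) \<le> real (subdegree (coeff f k)) * real q"
      using q that(1) by (simp add: divide_le_eq field_simps)
    then show ?thesis by (metis mult.commute of_nat_le_iff of_nat_mult)
  qed
  have decomp: "ramify q a = ramify q (fps_shift (subdegree a) a) * fps_X ^ (q * subdegree a)" for a
    using arg_cong[OF subdegree_decompose[of a], of "ramify q"] ramify_hom(2)[OF q] ramify_X_power[OF q] by metis
  \<comment> \<open>The coefficients after the division. For a nonzero coefficient below
    \<open>m\<close> the subtraction is exact by minimality of the slope, with difference 0 at
    \<open>i0\<close>; above \<open>m\<close> a positive power of \<open>fps_X\<close>
    remains.\<close>
  define t where "t k = (if k < m then ramify q (fps_shift (subdegree (coeff f k)) (coeff f k)) *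
      fps_X ^ (q * subdegree (coeff f k) - p * (m - k)) else ramify q (coeff f k) * fps_X ^ (p * (k - m)))" for k
  have t0: "t k = 0" if "coeff f k = 0" for k using that by (simp add: t_def)
  have t: "fps_X ^ (p * m) * t k = ramify q (coeff f k) * (fps_X ^ p) ^ k" for k
  proof (cases "coeff f k = 0")
    case nz: False
    show ?thesis
    proof (cases "k < m")
      case True
      have "p * m = p * (m - k) + p * k" using True by (simp add: distrib_left[symmetric])
      moreover have "q * subdegree (coeff f k) = p * (m - k) + (q * subdegree (coeff f k) - p * (m - k))"
        using ineq[OF True nz] by simp
      ultimately have "fps_X ^ (p * m) * fps_X ^ (q * subdegree (coeff f k) - p * (m - k)) =
          (fps_X ^ (q * subdegree (coeff f k)) * (fps_X ^ p) ^ k :: complex fps)"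
        by (simp add: power_add[symmetric] power_mult[symmetric])
      then show ?thesis using True decomp[of "coeff f k"] by (simp add: t_def mult_ac)
    next
      case False
      then have "p * m + p * (k - m) = p * k" by (simp add: distrib_left[symmetric])
      then show ?thesis using False by (simp add: t_def power_add[symmetric] power_mult[symmetric] mult_ac)
    qed
  qed (simp add: t0)
  define g where "g = Abs_poly t"
  have g: "coeff g k = t k" for k
    unfolding g_def by (subst coeff_Abs_poly[of "degree f"]) (auto simp: t0 coeff_eq_0)
  have eq: "smult (fps_X ^ (p * m)) g = pcompose (map_poly (ramify q) f) [:0, fps_X ^ p:]"
    by (rule poly_eqI) (simp only: coeff_smult g coeff_pcompose_linear t, simp add: coeff_map_poly mult.commute)
  have "coeff g k $ 0 = 0" if "k > m" for k
    using that p by (simp add: g t_def)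
  moreover have "coeff g m $ 0 \<noteq> 0" using f(2) q by (simp add: g t_def ramify_hom)
  moreover have "coeff g (m - 1) $ 0 = 0" using tr by (simp add: g t0)
  moreover have "coeff g i0 $ 0 \<noteq> 0"
    using i0' q by (simp add: g t_def ramify_hom p_def q_def mult.commute)
  ultimately show ?thesis using that p q eq i0'(1) by blast
qed

text \<open>Induction on \<open>m\<close>, the multiplicity of 0 as a root modulo
  \<open>fps_X\<close>. Translation and rescaling produce a reduction of degree \<open>m\<close>
  with a root of multiplicity strictly between 0 and \<open>m\<close>; moving that root to 0 sets up
  the induction hypothesis. If nothing is left below \<open>m\<close> after translation, 0 is
  already a root.\<close>

theorem puiseux_root_regular:
  fixes f :: "complex fps poly"
  assumes "\<And>i. i < m \<Longrightarrow> coeff f i $ 0 = 0" "coeff f m $ 0 \<noteq> 0" "m \<ge> 1"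
  shows "\<exists>q r. q \<ge> 1 \<and> r $ 0 = 0 \<and> poly (map_poly (ramify q) f) r = 0"
  using assms
proof (induction m arbitrary: f rule: less_induct)
  case (less m)
  obtain b where b: "b $ 0 = 0" "coeff (pcompose f [:b, 1:]) (m - 1) = 0"
    "\<And>i. coeff (pcompose f [:b, 1:]) i $ 0 = coeff f i $ 0"
    using translate_to_trace_zero[OF less.prems] by blast
  define f1 where "f1 = pcompose f [:b, 1:]"
  have shift: "poly (map_poly (ramify q) f) (ramify q b + w) = poly (map_poly (ramify q) f1) w" if "q \<ge> 1" for q w
  proof -
    have "map_poly (ramify q) f1 = pcompose (map_poly (ramify q) f) (map_poly (ramify q) [:b, 1:])"
      unfolding f1_def using ramify_hom[OF that] by (intro map_poly_pcompose_hom) simp_all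
    also have "map_poly (ramify q) [:b, 1:] = [:ramify q b, 1:]"
      using ramify_hom(4)[OF that, of 1] by (simp add: map_poly_pCons)
    finally show ?thesis by (simp add: poly_pcompose)
  qed
  show ?case
  proof (cases "\<exists>i<m. coeff f1 i \<noteq> 0")
    case False
    then have "poly f1 0 = 0" using less.prems(3) by (simp add: poly_0_coeff_0)
    moreover have id: "map_poly (ramify 1) F = F" for F by (rule poly_eqI) (simp add: coeff_map_poly)
    ultimately have "poly (map_poly (ramify 1) f) (ramify 1 b + 0) = 0" by (subst shift) simp_all
    then have "poly (map_poly (ramify 1) f) b = 0" by (simp only: ramify_1 One_nat_def add_0_right)
    then show ?thesis using b(1) by blast
  next
    case True
    then obtain i where i: "i < m" "coeff f1 i \<noteq> 0" by blast
    have f1: "coeff f1 j $ 0 = 0" if "j < m" for j using that less.prems(1) b(3) by (simp add: f1_def)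
    have f1m: "coeff f1 m $ 0 \<noteq> 0" using less.prems(2) b(3) by (simp add: f1_def)
    obtain p q g i0 where pq: "p \<ge> 1" "q \<ge> 1"
      and g: "smult (fps_X ^ (p * m)) g = pcompose (map_poly (ramify q) f1) [:0, fps_X ^ p:]"
      and red: "\<And>k. k > m \<Longrightarrow> coeff g k $ 0 = 0" "coeff g m $ 0 \<noteq> 0" "coeff g (m - 1) $ 0 = 0"
        "i0 < m" "coeff g i0 $ 0 \<noteq> 0"
      using newton_rescaling[OF f1 f1m b(2)[folded f1_def] i] by metis
    define R where "R = map_poly (\<lambda>a. a $ 0) g"
    have R: "coeff R k = coeff g k $ 0" for k by (simp add: R_def coeff_map_poly)
    have "degree R = m"
      using red(1,2) by (intro antisym degree_le le_degree) (simp_all add: R)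
    then obtain c where c: "1 \<le> order c R" "order c R < m"
      using ex_root_of_smaller_order[of R m i0] less.prems(3) red(3-5) by (auto simp: R)
    have "R \<noteq> 0" using red(2) R[of m] by auto
    define h where "h = pcompose g [:fps_const c, 1:]"
    have h: "coeff h k $ 0 = coeff (pcompose R [:c, 1:]) k" for k
    proof -
      have "map_poly (\<lambda>a. a $ 0) h = pcompose R (map_poly (\<lambda>a. a $ 0) [:fps_const c, 1:])"
        unfolding h_def R_def by (rule map_poly_pcompose_hom) simp_all
      also have "map_poly (\<lambda>a. a $ 0) [:fps_const c, 1:] = [:c, 1:]" by (simp add: map_poly_pCons)
      finally have "coeff (map_poly (\<lambda>a. a $ 0) h) k = coeff (pcompose R [:c, 1:]) k" by simp
      then show ?thesis by (simp add: coeff_map_poly)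
    qed
    obtain q' r where r: "q' \<ge> 1" "r $ 0 = 0" "poly (map_poly (ramify q') h) r = 0"
      using less.IH[OF c(2), of h] coeff_shift_root[OF \<open>R \<noteq> 0\<close>] c(1) unfolding h by blast
    note hom = ramify_hom[OF r(1)]
    have q'1: "ramify q' 1 = 1" using hom(4)[of 1] by simp
    have "map_poly (ramify q') h = pcompose (map_poly (ramify q') g) (map_poly (ramify q') [:fps_const c, 1:])"
      unfolding h_def using hom by (intro map_poly_pcompose_hom) simp_all
    also have "map_poly (ramify q') [:fps_const c, 1:] = [:fps_const c, 1:]"
      by (simp add: map_poly_pCons hom q'1)
    finally have groot: "poly (map_poly (ramify q') g) (fps_const c + r) = 0"
      using r(3) by (simp add: poly_pcompose)
    have "smult (fps_X ^ (q' * (p * m))) (map_poly (ramify q') g) = map_poly (ramify q') (smult (fps_X ^ (p * m)) g)"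
      by (rule poly_eqI) (simp add: coeff_map_poly hom ramify_X_power[OF r(1)])
    also have "\<dots> = pcompose (map_poly (ramify q') (map_poly (ramify q) f1)) (map_poly (ramify q') [:0, fps_X ^ p:])"
      unfolding g using hom by (intro map_poly_pcompose_hom) simp_all
    also have "map_poly (ramify q') (map_poly (ramify q) f1) = map_poly (ramify (q * q')) f1"
      using pq r by (intro map_poly_ramify_ramify) simp_all
    also have "map_poly (ramify q') [:0, fps_X ^ p:] = [:0, fps_X ^ (q' * p):]"
      by (simp add: map_poly_pCons ramify_X_power[OF r(1)])
    finally have eq: "pcompose (map_poly (ramify (q * q')) f1) [:0, fps_X ^ (q' * p):]
      = smult (fps_X ^ (q' * (p * m))) (map_poly (ramify q') g)" by simp
    \<comment> \<open>Undoes the rescaling: the root \<open>c + r\<close> of the rescaled polynomial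
      times the ramified weight.\<close>
    define w where "w = (fps_const c + r) * fps_X ^ (q' * p)"
    have "poly (map_poly (ramify (q * q')) f1) w = poly (pcompose (map_poly (ramify (q * q')) f1) [:0, fps_X ^ (q' * p):]) (fps_const c + r)"
      by (simp add: poly_pcompose w_def)
    also have "\<dots> = 0" unfolding eq by (simp add: groot)
    finally have "poly (map_poly (ramify (q * q')) f) (ramify (q * q') b + w) = 0"
      using pq r by (subst shift) simp_all
    moreover have "(ramify (q * q') b + w) $ 0 = 0"
      using pq r b(1) by (simp add: w_def ramify_hom)
    moreover have "q * q' \<ge> 1" using pq r by simp
    ultimately show ?thesis by blast
  qed
qed

subsection \<open>Power series in a root of \<open>x\<close>\<close>

text \<open>The series \<open>f(x^(1/k))\<close>; for positive \<open>k\<close> the index selected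
  by \<open>THE\<close> is unique.\<close>

definition embed :: "nat \<Rightarrow> complex fps \<Rightarrow> gps" where
  "embed k f = Abs_gps (\<lambda>a. if \<exists>n::nat. a = real n / real k then f $ (THE n. a = real n / real k) else 0)"

context
  fixes k :: nat
  assumes k: "k \<ge> 1"
begin

lemma gcoeff_embed: "gcoeff (embed k f) a = (if \<exists>n::nat. a = real n / real k then f $ (THE n. a = real n / real k) else 0)"
  unfolding embed_def
proof (rule fun_cong[OF gcoeff_Abs])
  fix r
  let ?h = "\<lambda>a. if \<exists>n::nat. a = real n / real k then f $ (THE n. a = real n / real k) else 0"
  have "{a. ?h a \<noteq> 0 \<and> a \<le> r} \<subseteq> (\<lambda>n. real n / real k) ` {..nat \<lceil>r * real k\<rceil>}"
  proof safe
    fix a assume a: "?h a \<noteq> 0" "a \<le> r"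
    then obtain n :: nat where n: "a = real n / real k" by (auto split: if_splits)
    then have "real n = a * real k" using k by simp
    also have "\<dots> \<le> r * real k" using a(2) by (intro mult_right_mono) simp_all
    finally have "real n \<le> r * real k" .
    then have "n \<le> nat \<lceil>r * real k\<rceil>" by linarith
    with n show "a \<in> (\<lambda>n. real n / real k) ` {..nat \<lceil>r * real k\<rceil>}" by blast
  qed
  then show "finite {a. ?h a \<noteq> 0 \<and> a \<le> r}" by (rule finite_subset) simp
qed

lemma gcoeff_embed_fraction [simp]: "gcoeff (embed k f) (real n / real k) = f $ n"
proof -
  have "(THE m. real n / real k = real m / real k) = n"
    using k by (intro the_equality) auto
  then show ?thesis unfolding gcoeff_embed by auto
qed

lemma gcoeff_embed_nonzeroD:
  assumes "gcoeff (embed k f) a \<noteq> 0"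
  shows "\<exists>n. a = real n / real k"
  using assms unfolding gcoeff_embed by (auto split: if_splits)

lemma gps_eq_embedI:
  assumes "\<And>n. gcoeff g (real n / real k) = f $ n" "\<And>a. gcoeff g a \<noteq> 0 \<Longrightarrow> \<exists>n. a = real n / real k"
  shows "g = embed k f"
proof (rule gps_eqI)
  fix a
  show "gcoeff g a = gcoeff (embed k f) a"
  proof (cases "\<exists>n. a = real n / real k")
    case True
    then show ?thesis using assms(1) by auto
  next
    case False
    then show ?thesis using assms(2) gcoeff_embed_nonzeroD by metis
  qed
qed

lemma embed_0 [simp]: "embed k 0 = 0"
  by (rule gps_eq_embedI[symmetric]) simp_all

lemma embed_add: "embed k f + embed k g = embed k (f + g)"
proof (rule gps_eq_embedI)
  fix a assume "gcoeff (embed k f + embed k g) a \<noteq> 0"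
  then have "gcoeff (embed k f) a \<noteq> 0 \<or> gcoeff (embed k g) a \<noteq> 0" by auto
  then show "\<exists>n. a = real n / real k" using gcoeff_embed_nonzeroD by blast
qed simp

lemma embed_mult: "embed k f * embed k g = embed k (f * g)"
proof (rule gps_eq_embedI)
  fix n
  have "gcoeff (embed k f * embed k g) (real n / real k) =
    (\<Sum>a\<in>(\<lambda>i. real i / real k) ` {..n}. gcoeff (embed k f) a * gcoeff (embed k g) (real n / real k - a))"
  proof (rule gcoeff_mult)
    fix a assume "gcoeff (embed k f) a \<noteq> 0" "gcoeff (embed k g) (real n / real k - a) \<noteq> 0"
    then obtain i j where i: "a = real i / real k" and j: "real n / real k - a = real j / real k"
      using gcoeff_embed_nonzeroD by meson
    then have "real n = real i + real j" using k by (simp add: field_simps)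
    then have "i \<le> n" by linarith
    with i show "a \<in> (\<lambda>i. real i / real k) ` {..n}" by blast
  qed simp
  also have "\<dots> = (\<Sum>i\<le>n. gcoeff (embed k f) (real i / real k) * gcoeff (embed k g) (real n / real k - real i / real k))"
    using k by (subst sum.reindex) (auto simp: inj_on_def)
  also have "\<dots> = (\<Sum>i\<le>n. f $ i * g $ (n - i))"
  proof (rule sum.cong[OF refl])
    fix i assume "i \<in> {..n}"
    then have "real n / real k - real i / real k = real (n - i) / real k"
      by (simp add: of_nat_diff diff_divide_distrib)
    then show "gcoeff (embed k f) (real i / real k) * gcoeff (embed k g) (real n / real k - real i / real k) = f $ i * g $ (n - i)"
      by (simp only: gcoeff_embed_fraction)
  qed
  finally show "gcoeff (embed k f * embed k g) (real n / real k) = (f * g) $ n"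
    by (simp add: fps_mult_nth atLeast0AtMost)
next
  fix a assume "gcoeff (embed k f * embed k g) a \<noteq> 0"
  then obtain u where "gcoeff (embed k f) u \<noteq> 0" "gcoeff (embed k g) (a - u) \<noteq> 0" by (rule gcoeff_mult_nonzeroD)
  then obtain i j where "u = real i / real k" "a - u = real j / real k" using gcoeff_embed_nonzeroD by meson
  then have "a = real (i + j) / real k" by (simp add: add_divide_distrib)
  then show "\<exists>n. a = real n / real k" by blast
qed

lemma embed_monom: "embed k (fps_const c * fps_X ^ j) = gmonom c (real j / real k)"
proof (rule gps_eq_embedI[symmetric])
  show "gcoeff (gmonom c (real j / real k)) (real n / real k) = (fps_const c * fps_X ^ j) $ n" for n
    using k by (simp add: gcoeff_gmonom fps_X_power_mult_right_nth)
qed (auto simp: gcoeff_gmonom split: if_splits)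

lemma embed_const: "embed k (fps_const c) = gmonom c 0"
  using embed_monom[of c 0] by simp

lemma embed_power: "embed k f ^ n = embed k (f ^ n)"
proof (induction n)
  case 0
  then show ?case using embed_const[of 1] by simp
qed (simp add: embed_mult)

lemma embed_sum: "(\<Sum>i\<in>S. embed k (F i)) = embed k (sum F S)"
  by (induction S rule: infinite_finite_induct) (simp_all add: embed_add)

text \<open>For \<open>t = x^(1/k)\<close>, \<open>d/dt = k t^(k-1) d/dx\<close>.\<close>

lemma embed_deriv: "embed k (fps_const (of_nat k) * fps_X ^ (k - 1)) * gderiv (embed k f) = embed k (fps_deriv f)"
proof (rule gps_eq_embedI)
  have coef: "gcoeff (embed k (fps_const (of_nat k) * fps_X ^ (k - 1)) * gderiv (embed k f)) a
    = of_real (real k * a + 1) * gcoeff (embed k f) (a + 1 / real k)" for a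
  proof -
    have 1: "a - real (k - 1) / real k + 1 = a + 1 / real k" using k by (simp add: field_simps of_nat_diff)
    have 2: "real k * a + 1 = real k * (a + 1 / real k)" using k by (simp add: field_simps)
    show ?thesis
      unfolding embed_monom gcoeff_gmonom_mult gcoeff_gderiv 1 2 by simp
  qed
  fix a assume "gcoeff (embed k (fps_const (of_nat k) * fps_X ^ (k - 1)) * gderiv (embed k f)) a \<noteq> 0"
  then have a: "complex_of_real (real k * a + 1) \<noteq> 0" "gcoeff (embed k f) (a + 1 / real k) \<noteq> 0"
    unfolding coef by auto
  then obtain n where n: "a + 1 / real k = real n / real k" using gcoeff_embed_nonzeroD by blast
  then have n': "real k * a + 1 = real n" using k by (simp add: field_simps)
  with a(1) have "n \<noteq> 0" by auto
  then obtain m where "n = Suc m" by (cases n) auto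
  then have "a = real m / real k" using n' k by (simp add: field_simps)
  then show "\<exists>n. a = real n / real k" by blast
next
  fix n
  have "real n / real k - real (k - 1) / real k + 1 = real (Suc n) / real k"
    using k by (simp add: field_simps of_nat_diff)
  moreover have "of_nat k * (complex_of_real (real (Suc n) / real k) * f $ Suc n) = of_nat (Suc n) * f $ Suc n"
    using k by (simp add: field_simps del: of_nat_Suc)
  ultimately show "gcoeff (embed k (fps_const (of_nat k) * fps_X ^ (k - 1)) * gderiv (embed k f)) (real n / real k) = fps_deriv f $ n"
    unfolding embed_monom gcoeff_gmonom_mult gcoeff_gderiv
    by (simp only: gcoeff_embed_fraction fps_deriv_nth Suc_eq_plus1[symmetric])
qed

end

subsection \<open>Existence of a solution through every point\<close>

lemma poly_map_poly_upto:
  fixes h :: "'a::zero \<Rightarrow> 'b::comm_semiring_1"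
  assumes "degree p \<le> n" "h 0 = 0"
  shows "poly (map_poly h p) y = (\<Sum>i\<le>n. h (coeff p i) * y ^ i)"
proof -
  have "poly (map_poly h p) y = (\<Sum>i\<le>degree (map_poly h p). coeff (map_poly h p) i * y ^ i)"
    by (rule poly_altdef)
  also have "\<dots> = (\<Sum>i\<le>n. coeff (map_poly h p) i * y ^ i)"
  proof (rule sum.mono_neutral_left)
    have "degree (map_poly h p) \<le> degree p"
      by (rule degree_le) (simp add: coeff_map_poly assms(2) coeff_eq_0)
    then show "{..degree (map_poly h p)} \<subseteq> {..n}" using assms(1) by auto
  qed (simp_all add: coeff_eq_0)
  finally show ?thesis using assms(2) by (simp add: coeff_map_poly)
qed

definition expand :: "complex poly \<Rightarrow> complex fps \<Rightarrow> complex fps" where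
  "expand p y = poly (map_poly fps_const p) y"

lemma expand_compose:
  assumes "T $ 0 = 0"
  shows "expand p y oo T = expand p (y oo T)"
  by (induction p)
    (simp_all add: expand_def map_poly_pCons fps_compose_add_distrib fps_compose_mult_distrib[OF assms])

lemma expand_nth_0: "expand p y $ 0 = poly p (y $ 0)"
  by (induction p) (simp_all add: expand_def map_poly_pCons)

lemma expand_eq_fps_of_poly: "expand p (fps_const c + fps_X) = fps_of_poly (pcompose p [:c, 1:])"
proof (induction p)
  case (pCons a p)
  have "fps_of_poly [:c, 1:] = fps_const c + fps_X" by (simp add: fps_of_poly_pCons)
  then show ?case using pCons
    by (simp add: expand_def map_poly_pCons pcompose_pCons fps_of_poly_add fps_of_poly_mult)
qed (simp add: expand_def)

lemma expand_eq_0_iff: "expand p (fps_const c + fps_X) = 0 \<longleftrightarrow> p = 0"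
proof -
  have "fps_of_poly (pcompose p [:c, 1:]) = 0 \<longleftrightarrow> pcompose p [:c, 1:] = 0"
    by (metis fps_of_poly_0 fps_of_poly_eq_iff)
  then show ?thesis unfolding expand_eq_fps_of_poly by (simp add: pcompose_eq_0_iff)
qed

lemma ramify_eq_0_iff:
  assumes "q \<ge> 1"
  shows "ramify q a = 0 \<longleftrightarrow> a = 0"
  using assms unfolding ramify_def by (subst fps_compose_eq_0_iff) auto

lemma embed_expand:
  assumes "k \<ge> 1" "degree p \<le> n"
  shows "embed k (expand p y) = (\<Sum>i\<le>n. gmonom (coeff p i) 0 * embed k y ^ i)"
  unfolding expand_def using assms
  by (subst poly_map_poly_upto[OF assms(2)])
    (simp_all add: embed_sum[symmetric] embed_mult[symmetric] embed_const embed_power)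

text \<open>\<open>\<phi>\<close> stands for \<open>1 / y1\<close> along \<open>y = c0 + z\<close>,
  a root of \<open>P\<close> with its coefficients in \<open>y1\<close> reversed. The new leading
  coefficient is a unit at \<open>z = 0\<close> because \<open>P(c0, 0)\<close> is nonzero, so the
  reduction keeps its positive degree and has a root in \<complex> to expand around.\<close>

lemma reciprocal_puiseux_root:
  fixes P :: "complex poly poly"
  assumes "degree P \<ge> 1" "poly (coeff P 0) c0 \<noteq> 0"
  obtains q \<phi> where "q \<ge> 1" "\<phi> \<noteq> 0"
    "(\<Sum>j\<le>degree P. expand (coeff P (degree P - j)) (fps_const c0 + fps_X ^ q) * \<phi> ^ j) = 0"
proof -
  define N where "N = degree P"
  define y where "y = fps_const c0 + fps_X"
  define F where "F = (\<Sum>j\<le>N. monom (expand (coeff P (N - j)) y) j)"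
  have F: "coeff F j = (if j \<le> N then expand (coeff P (N - j)) y else 0)" for j
    by (simp add: F_def coeff_sum)
  define R where "R = map_poly (\<lambda>a. a $ 0) F"
  have R: "coeff R j = coeff F j $ 0" for j by (simp add: R_def coeff_map_poly)
  have RN: "coeff R N \<noteq> 0" using assms(2) by (simp add: R F expand_nth_0 y_def)
  then have "R \<noteq> 0" by auto
  have "N \<le> degree R" using RN by (rule le_degree)
  then have "\<not> constant (poly R)" using assms(1) by (simp add: constant_degree N_def)
  then obtain c where c: "poly R c = 0" using fundamental_theorem_of_algebra by blast
  define F1 where "F1 = pcompose F [:fps_const c, 1:]"
  have F1: "coeff F1 i $ 0 = coeff (pcompose R [:c, 1:]) i" for i
  proof -
    have "map_poly (\<lambda>a. a $ 0) F1 = pcompose R (map_poly (\<lambda>a. a $ 0) [:fps_const c, 1:])"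
      unfolding F1_def R_def by (rule map_poly_pcompose_hom) simp_all
    also have "map_poly (\<lambda>a. a $ 0) [:fps_const c, 1:] = [:c, 1:]" by (simp add: map_poly_pCons)
    finally have "coeff (map_poly (\<lambda>a. a $ 0) F1) i = coeff (pcompose R [:c, 1:]) i" by simp
    then show ?thesis by (simp add: coeff_map_poly)
  qed
  have "order c R \<ge> 1" using c \<open>R \<noteq> 0\<close> by (simp add: order_root Suc_le_eq)
  then obtain q r where q: "q \<ge> 1" and r: "poly (map_poly (ramify q) F1) r = 0"
    using puiseux_root_regular[of "order c R" F1] coeff_shift_root[OF \<open>R \<noteq> 0\<close>] unfolding F1 by blast
  note hom = ramify_hom[OF q]
  define \<phi> where "\<phi> = fps_const c + r"
  have "ramify q 1 = 1" using hom(4)[of 1] by simp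
  then have "map_poly (ramify q) [:fps_const c, 1:] = [:fps_const c, 1:]"
    using hom(4)[of c] by (simp add: map_poly_pCons)
  moreover have "map_poly (ramify q) F1 = pcompose (map_poly (ramify q) F) (map_poly (ramify q) [:fps_const c, 1:])"
    unfolding F1_def using hom by (intro map_poly_pcompose_hom) simp_all
  ultimately have "poly (map_poly (ramify q) F) \<phi> = 0"
    using r by (simp add: poly_pcompose \<phi>_def)
  moreover have "degree F \<le> N" unfolding F_def by (intro degree_sum_le) (simp_all add: order.trans[OF degree_monom_le])
  ultimately have root: "(\<Sum>j\<le>N. ramify q (expand (coeff P (N - j)) y) * \<phi> ^ j) = 0"
    by (simp add: poly_map_poly_upto[of F N] F)
  \<comment> \<open>At \<open>\<phi> = 0\<close> only the term \<open>j = 0\<close> survives, which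
    carries the leading coefficient of \<open>P\<close>.\<close>
  have "\<phi> \<noteq> 0"
  proof
    assume "\<phi> = 0"
    then have "ramify q (expand (coeff P N) y) = 0" using root by (simp add: power_0_left sum.delta if_distrib cong: if_cong)
    then have "coeff P N = 0" using q by (simp add: ramify_eq_0_iff expand_eq_0_iff y_def)
    then show False using assms(1) by (auto simp: N_def)
  qed
  moreover have "ramify q (expand p y) = expand p (fps_const c0 + fps_X ^ q)" for p
    using q by (simp add: ramify_def expand_compose y_def fps_compose_add_distrib)
  ultimately show ?thesis using that q root by (simp add: N_def)
qed

text \<open>Integrates \<open>dx = \<phi> dz\<close> with \<open>z = \<tau>^q\<close>, takes a \<open>k\<close>-th root of \<open>x\<close> as the new parameter, and
  inverts.\<close>

lemma integrate_and_invert: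
  fixes \<phi> :: "complex fps"
  assumes "q \<ge> 1" "\<phi> \<noteq> 0"
  obtains k T where "k \<ge> 1" "T $ 0 = 0"
    "(\<phi> oo T) * fps_deriv (T ^ q) = fps_const (of_nat k) * fps_X ^ (k - 1)"
proof -
  \<comment> \<open>The independent variable \<open>x\<close> as a series in \<open>\<tau>\<close>,
    since \<open>dz = q \<tau>^(q-1) d\<tau>\<close>.\<close>
  define \<xi> where "\<xi> = fps_integral0 (\<phi> * fps_const (of_nat q) * fps_X ^ (q - 1))"
  have \<xi>': "fps_deriv \<xi> = \<phi> * fps_const (of_nat q) * fps_X ^ (q - 1)"
    unfolding \<xi>_def by (rule fps_deriv_fps_integral)
  have "fps_deriv \<xi> \<noteq> 0" unfolding \<xi>' using assms by simp
  then have "\<xi> \<noteq> 0" by auto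
  moreover have "\<xi> $ 0 = 0" by (simp add: \<xi>_def)
  ultimately have "subdegree \<xi> \<noteq> 0" unfolding subdegree_eq_0_iff by simp
  then obtain k' where k': "subdegree \<xi> = Suc k'" by (cases "subdegree \<xi>") auto
  define \<eta> where "\<eta> = fps_shift (Suc k') \<xi>"
  have \<eta>: "\<xi> = \<eta> * fps_X ^ Suc k'" unfolding \<eta>_def k'[symmetric] by (rule subdegree_decompose)
  have \<eta>0: "\<eta> $ 0 \<noteq> 0" using \<open>\<xi> \<noteq> 0\<close> nth_subdegree_nonzero[of \<xi>] by (simp add: \<eta>_def k')
  \<comment> \<open>Any root of the leading coefficient would do; it fixes the branch of the
    radical.\<close>
  define w where "w = exp (Ln (\<eta> $ 0) / of_nat (Suc k'))"
  have w: "w ^ Suc k' = \<eta> $ 0"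
    unfolding w_def exp_of_nat_mult[symmetric] using \<eta>0 by (simp del: of_nat_Suc)
  define \<theta> where "\<theta> = fps_radical (\<lambda>_ _. w) (Suc k') \<eta>"
  have \<theta>: "\<theta> ^ Suc k' = \<eta>" unfolding \<theta>_def using power_radical[OF \<eta>0, of "\<lambda>_ _. w" k'] w by simp
  have "\<theta> $ 0 = w" by (simp add: \<theta>_def)
  moreover have "w \<noteq> 0" by (simp add: w_def)
  ultimately have X1: "(fps_X * \<theta>) $ 0 = 0" "(fps_X * \<theta>) $ 1 \<noteq> 0" by simp_all
  \<comment> \<open>\<open>fps_X * \<theta>\<close> is a root of \<open>x\<close> of exact order 1
    in \<open>\<tau>\<close>, hence invertible under composition; \<open>T\<close> expresses
    \<open>\<tau>\<close> through that root.\<close>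
  define T where "T = fps_inv (fps_X * \<theta>)"
  have T0: "T $ 0 = 0" by (simp add: T_def fps_inv_def)
  have "(fps_X * \<theta>) ^ Suc k' = \<xi>" unfolding power_mult_distrib \<theta> by (simp only: \<eta> mult.commute)
  then have "\<xi> oo T = ((fps_X * \<theta>) oo T) ^ Suc k'"
    by (simp only: fps_compose_power[OF T0])
  also have "(fps_X * \<theta>) oo T = fps_X" unfolding T_def by (rule fps_inv_right[OF X1])
  finally have "fps_deriv (\<xi> oo T) = fps_deriv (fps_X ^ Suc k')" by simp
  then have eq: "(fps_deriv \<xi> oo T) * fps_deriv T = fps_const (of_nat (Suc k')) * fps_X ^ k'"
    unfolding fps_compose_deriv[OF T0] by (simp only: fps_deriv_power fps_deriv_fps_X diff_Suc_1 mult_1_right)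
  have "fps_deriv \<xi> oo T = (\<phi> oo T) * fps_const (of_nat q) * T ^ (q - 1)"
    unfolding \<xi>' using T0 by (simp add: fps_compose_mult_distrib fps_compose_power[symmetric])
  then have "(\<phi> oo T) * fps_deriv (T ^ q) = (fps_deriv \<xi> oo T) * fps_deriv T"
    by (simp only: fps_deriv_power mult_ac)
  with eq T0 show ?thesis by (intro that[of "Suc k'" T]) simp_all
qed

lemma ex_solution_through_nonstationary:
  fixes P :: "complex poly poly"
  assumes "degree P \<ge> 1" "poly (coeff P 0) c0 \<noteq> 0"
  shows "\<exists>s. is_solution P (gcoeff s) \<and> (\<forall>\<mu><0. gcoeff s \<mu> = 0) \<and> gcoeff s 0 = c0"
proof -
  define N where "N = degree P"
  obtain q \<phi> where q: "q \<ge> 1" and "\<phi> \<noteq> 0"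
    and root: "(\<Sum>j\<le>N. expand (coeff P (N - j)) (fps_const c0 + fps_X ^ q) * \<phi> ^ j) = 0"
    using reciprocal_puiseux_root[OF assms] unfolding N_def by blast
  obtain k T where k: "k \<ge> 1" and T0: "T $ 0 = 0"
    and T: "(\<phi> oo T) * fps_deriv (T ^ q) = fps_const (of_nat k) * fps_X ^ (k - 1)"
    using integrate_and_invert[OF q \<open>\<phi> \<noteq> 0\<close>] by blast
  define y where "y = fps_const c0 + T ^ q"
  \<comment> \<open>\<open>dx/dt\<close> for \<open>x = t^k\<close>, while \<open>D\<close> is
    \<open>dy/dt\<close>; the relation \<open>D\<close> below says that \<open>\<phi>\<close>
    composed with \<open>T\<close> is \<open>dx/dy\<close>.\<close>
  define \<kappa> where "\<kappa> = (fps_const (of_nat k) * fps_X ^ (k - 1) :: complex fps)"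
  define D where "D = fps_deriv y"
  have D: "(\<phi> oo T) * D = \<kappa>" using T by (simp add: D_def y_def \<kappa>_def)
  have "(\<Sum>j\<le>N. expand (coeff P (N - j)) (fps_const c0 + fps_X ^ q) * \<phi> ^ j) oo T = 0"
    by (simp add: root)
  then have "(\<Sum>j\<le>N. expand (coeff P (N - j)) y * (\<phi> oo T) ^ j) = 0"
    using q by (simp add: fps_compose_sum_distrib fps_compose_mult_distrib[OF T0] expand_compose[OF T0]
        fps_compose_add_distrib fps_compose_power[OF T0, symmetric] y_def T0)
  \<comment> \<open>Multiplication by \<open>D ^ N\<close> clears the reciprocals and makes the
    equation homogeneous in \<open>\<kappa>\<close> and \<open>D\<close>; passing to
    \<open>x\<close> then produces a common factor \<open>K ^ N\<close>, which cancels.\<close>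
  then have "0 = (\<Sum>j\<le>N. expand (coeff P (N - j)) y * (\<phi> oo T) ^ j) * D ^ N" by simp
  also have "\<dots> = (\<Sum>j\<le>N. expand (coeff P (N - j)) y * (\<kappa> ^ j * D ^ (N - j)))"
    unfolding sum_distrib_right
  proof (rule sum.cong[OF refl])
    fix j assume "j \<in> {..N}"
    then have "D ^ N = D ^ j * D ^ (N - j)" by (simp flip: power_add)
    then have "(\<phi> oo T) ^ j * D ^ N = \<kappa> ^ j * D ^ (N - j)"
      by (simp add: power_mult_distrib flip: D)
    then show "expand (coeff P (N - j)) y * (\<phi> oo T) ^ j * D ^ N = expand (coeff P (N - j)) y * (\<kappa> ^ j * D ^ (N - j))"
      by (simp only: mult.assoc)
  qed
  also have "\<dots> = (\<Sum>j\<le>N. expand (coeff P j) y * (\<kappa> ^ (N - j) * D ^ j))"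
    by (rule sum.reindex_bij_witness[of _ "\<lambda>j. N - j" "\<lambda>j. N - j"]) auto
  finally have fps_eq: "(\<Sum>j\<le>N. expand (coeff P j) y * (\<kappa> ^ (N - j) * D ^ j)) = 0" by simp
  define s where "s = embed k y"
  define K where "K = embed k \<kappa>"
  have sD: "embed k D = K * gderiv s" unfolding D_def s_def K_def \<kappa>_def by (rule embed_deriv[OF k, symmetric])
  have K0: "K \<noteq> 0" using k by (simp add: K_def \<kappa>_def embed_monom)
  obtain n where n: "n \<ge> 1" "degree P \<le> n" "\<And>j. degree (coeff P j) \<le> n"
    using ex_degree_bound[of P] by blast
  have "0 = embed k (\<Sum>j\<le>N. expand (coeff P j) y * (\<kappa> ^ (N - j) * D ^ j))" using fps_eq k by simp
  also have "\<dots> = (\<Sum>j\<le>N. (\<Sum>i\<le>n. gmonom (coeff (coeff P j) i) 0 * s ^ i) * (K ^ (N - j) * (K * gderiv s) ^ j))"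
    using k by (simp add: embed_sum[symmetric] embed_mult[symmetric] embed_power[symmetric] embed_expand[OF k n(3)] sD
        flip: s_def K_def)
  also have "\<dots> = (\<Sum>j\<le>N. K ^ N * ((\<Sum>i\<le>n. gmonom (coeff (coeff P j) i) 0 * s ^ i) * gderiv s ^ j))"
  proof (rule sum.cong[OF refl])
    fix j assume "j \<in> {..N}"
    then have "K ^ (N - j) * K ^ j = K ^ N" by (simp flip: power_add)
    then have "K ^ (N - j) * (K * gderiv s) ^ j = K ^ N * gderiv s ^ j"
      by (simp add: power_mult_distrib flip: mult.assoc)
    then show "(\<Sum>i\<le>n. gmonom (coeff (coeff P j) i) 0 * s ^ i) * (K ^ (N - j) * (K * gderiv s) ^ j)
        = K ^ N * ((\<Sum>i\<le>n. gmonom (coeff (coeff P j) i) 0 * s ^ i) * gderiv s ^ j)"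
      by (simp only: mult.left_commute)
  qed
  also have "\<dots> = K ^ N * (\<Sum>j\<le>N. (\<Sum>i\<le>n. gmonom (coeff (coeff P j) i) 0 * s ^ i) * gderiv s ^ j)"
    by (simp only: sum_distrib_left)
  finally have "(\<Sum>j\<le>N. (\<Sum>i\<le>n. gmonom (coeff (coeff P j) i) 0 * s ^ i) * gderiv s ^ j) = 0"
    using K0 by simp
  also have "(\<Sum>j\<le>N. (\<Sum>i\<le>n. gmonom (coeff (coeff P j) i) 0 * s ^ i) * gderiv s ^ j)
      = (\<Sum>j\<le>n. (\<Sum>i\<le>n. gmonom (coeff (coeff P j) i) 0 * s ^ i) * gderiv s ^ j)"
    using n(2) by (intro sum.mono_neutral_left) (auto simp: N_def coeff_eq_0)
  also have "\<dots> = taylor (\<lambda>i j. coeff (coeff P j) i) n 0 0 s (gderiv s)"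
    unfolding taylor_def sum_distrib_right by (subst sum.swap) simp
  finally have "is_solution P (gcoeff s)" by (simp add: is_solution_iff_taylor[OF n(2,3)])
  moreover have "gcoeff s \<mu> = 0" if "\<mu> < 0" for \<mu>
  proof (rule ccontr)
    assume "gcoeff s \<mu> \<noteq> 0"
    then obtain m where "\<mu> = real m / real k" using gcoeff_embed_nonzeroD[OF k] unfolding s_def by blast
    with that show False by (simp add: divide_less_0_iff)
  qed
  moreover have "gcoeff s 0 = c0"
    using gcoeff_embed_fraction[OF k, of y 0] q T0 by (simp add: s_def y_def)
  ultimately show ?thesis by blast
qed

lemma ex_solution_through:
  fixes P :: "complex poly poly"
  assumes "degree P \<ge> 1"
  shows "\<exists>s. is_solution P (gcoeff s) \<and> (\<forall>\<mu><0. gcoeff s \<mu> = 0) \<and> gcoeff s 0 = c0"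
proof (cases "poly (coeff P 0) c0 = 0")
  case True
  obtain n where n: "n \<ge> 1" "degree P \<le> n" "\<And>j. degree (coeff P j) \<le> n"
    using ex_degree_bound[of P] by blast
  have "taylor (\<lambda>i j. coeff (coeff P j) i) n 0 0 (gmonom c0 0) 0
      = (\<Sum>i\<le>n. \<Sum>j\<in>{0}. gmonom (coeff (coeff P j) i) 0 * gmonom c0 0 ^ i)"
    unfolding taylor_def by (intro sum.cong refl sum.mono_neutral_cong_right) (auto simp: power_0_left)
  also have "\<dots> = (\<Sum>i\<le>n. gmonom (coeff (coeff P 0) i * c0 ^ i) 0)"
    by (simp add: gmonom_power gmonom_mult_gmonom)
  also have "\<dots> = gmonom (\<Sum>i\<le>n. coeff (coeff P 0) i * c0 ^ i) 0"
    by (rule gps_eqI) (simp add: gcoeff_gmonom)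
  also have "(\<Sum>i\<le>n. coeff (coeff P 0) i * c0 ^ i) = poly (coeff P 0) c0"
    using poly_map_poly_upto[OF n(3)[of 0], of "\<lambda>x. x" c0] by (simp add: map_poly_idI)
  finally have "is_solution P (gcoeff (gmonom c0 0))"
    using True by (simp add: is_solution_iff_taylor[OF n(2,3)] gderiv_gmonom_0)
  then show ?thesis by (intro exI[of _ "gmonom c0 0"]) (simp add: gcoeff_gmonom)
qed (rule ex_solution_through_nonstationary[OF assms])

text \<open>Autonomy permits translation: for the third part \<open>s\<close> is read as a series in
  powers of \<open>x - x0\<close>, and passing through the point means no negative exponents and
  constant term \<open>c0\<close>.\<close>

theorem theorem4:
  fixes P :: "complex poly poly"
  assumes "P \<noteq> 0" and "degree P \<ge> 1"
  shows "(\<forall>s\<in>Omega. is_solution P s \<longrightarrow> is_puiseux s)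
       \<and> (\<forall>s. is_puiseux s \<and> is_solution P s \<longrightarrow> is_conv_puiseux s)
       \<and> (\<forall>(x0::complex) (c0::complex). \<exists>s. is_conv_puiseux s \<and> is_solution P s
             \<and> (\<forall>\<mu><0. s \<mu> = 0) \<and> s 0 = c0)"
proof -
  \<comment> \<open>Proved for all of \<open>Omega\<close>, so rationality of exponents, boundedness
    of denominators and convergence come out together.\<close>
  have conv: "is_conv_puiseux s" if "s \<in> Omega" "is_solution P s" for s
  proof -
    have "gcoeff (Abs_gps s) = s" using that(1) by (rule Abs_gps_inverse)
    then show ?thesis using solution_is_conv_puiseux[OF assms(1), of "Abs_gps s"] that(2) by simp
  qed
  show ?thesis
  proof (intro conjI allI ballI impI)
    show "is_puiseux s" if "s \<in> Omega" "is_solution P s" for s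
      using conv[OF that] by (rule is_conv_puiseux_imp_is_puiseux)
    show "is_conv_puiseux s" if "is_puiseux s \<and> is_solution P s" for s
      using that by (intro conv) (simp_all add: is_puiseux_def)
    fix c0
    obtain f where "is_solution P (gcoeff f)" "\<forall>\<mu><0. gcoeff f \<mu> = 0" "gcoeff f 0 = c0"
      using ex_solution_through[OF assms(2), of c0] by (elim exE conjE)
    then show "\<exists>s. is_conv_puiseux s \<and> is_solution P s \<and> (\<forall>\<mu><0. s \<mu> = 0) \<and> s 0 = c0"
      using solution_is_conv_puiseux[OF assms(1)] by (intro exI[of _ "gcoeff f"]) simp
  qed
qed

end
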